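(* Let $d=2$, $T>0$ and $\lambda\in(0,1)$. Let $u_1,u_2$ be weak solutions of the incompressible Euler system on $(0,T)\times\mathbb T^2$ for the same initial data, with corresponding pressures $P_1$ and $P_2$, respectively. Let $\nu:=\lambda\delta_{(u_1,P_1)}+(1-\lambda)\delta_{(u_2,P_2)}$, which is an augmented measure-valued solution. Then the following are equivalent: (a) $\nu$ does not fulfill the Jensen condition, i.e. it is not true that $\langle S_\#\nu,f\rangle\ge Q_{\mathcal A_E}f(\langle S_\#\nu,\operatorname{id}\rangle)$ holds for all $f\in C(\mathbb R^N)$ on a subset of $(0,T)\times\mathbb T^2$ of full measure; (b) the set of points $(t,x)\in(0,T)\times\mathbb T^2$ where both $u_1\ne u_2$ and $P_1\ne P_2$ has positive Lebesgue measure.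
   Context: A Young measure on $(0,T)\times\mathbb T^d$ is a weakly*-measurable map into probability measures on some $\mathbb R^m$; $\langle\nu,f\rangle(t,x)=\int f\,d\nu_{(t,x)}$; pushforwards are pointwise. Augmented measure-valued solution of the incompressible Euler system with initial data $u_0\in L^1(\mathbb T^d)$: a Young measure $\mu$ with values in $\mathcal P(\mathbb R^d\times\mathbb R)$ (variables $(u,P)$) such that $\langle\mu,|u|^2\rangle\in L^\infty((0,T)\times\mathbb T^d)$ and $$\int_0^T\!\!\int_{\mathbb T^d}\partial_t\varphi\cdot\langle\mu,u\rangle+\nabla\varphi:\langle\mu,u\otimes u\rangle+\langle\mu,P\rangle\operatorname{div}\varphi\,dx\,dt=-\int_{\mathbb T^d}\varphi(0)\cdot u_0\,dx,\qquad\int_{\mathbb T^d}\nabla\psi\cdot\langle\mu,u\rangle\,dx=0\ \text{ (for a.e. }t)$$ for all $\varphi\in C_c^\infty([0,T)\times\mathbb T^d,\mathbb R^d)$, $\psi\in C^\infty(\mathbb T^d)$. A weak solution $u$ with corresponding pressure $P$ is the case $\mu=\delta_{(u,P)}$, $(u,P)\in L^1$; the corresponding average-free pressure is $P=(-\Delta)^{-1}\operatorname{div}\operatorname{div}(u\otimes u)$. Lift: $S(u,P)=\left(1,u,u\otimes u-\frac{|u|^2}d\mathbb E_d,P+\frac{|u|^2}d\right)\in\mathbb R\times\mathbb R^d\times S_0^d\times\mathbb R\cong\mathbb R^N$, where $\mathbb E_d$ is the identity matrix, $S_0^d$ = symmetric trace-free $d\times d$ matrices, $N=\dim(\mathbb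 R\times\mathbb R^d\times S_0^d\times\mathbb R)$. Here $d=2$. Operator and envelope: $\mathcal A_E(\rho,m,M,Q)=(\partial_tm+\operatorname{div}M+\nabla Q,\ \partial_t\rho+\operatorname{div}m)$ in the $d+1$ variables $(t,x)$, and $$Q_{\mathcal A_E}f(z)=\inf\left\{⨍_{\mathbb T^{d+1}}f(z+\varphi(y))\,dy:\ \varphi\in C^\infty(\mathbb T^{d+1},\mathbb R^N),\ \mathcal A_E\varphi=0,\ ⨍_{\mathbb T^{d+1}}\varphi\,dy=0\right\},$$ where ⨍ denotes the mean value integral. *)

theory Defs
  imports "HOL-Probability.Probability"
begin

text \<open>
  The torus is \<open>\<real>\<^sup>n / \<int>\<^sup>n\<close>. Continuous and smooth functions on it are functions on
  \<open>\<real>\<^sup>n\<close> that are 1-periodic in every coordinate. As a measure space it is represented by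
  the half-open unit cell with Lebesgue measure, which has total mass 1, so the mean value
  integral over the torus is the integral over \<open>unit_cell\<close>. Points of space-time
  are pairs \<open>(t, x)\<close>, and the torus of dimension \<open>d + 1\<close> lives on \<^typ>\<open>real \<times> (real ^ 'd)\<close>.
\<close>

definition unit_cell :: "'a::euclidean_space set" where
  "unit_cell = {x. \<forall>b\<in>Basis. 0 \<le> x \<bullet> b \<and> x \<bullet> b < 1}"

definition periodic :: "('a::euclidean_space \<Rightarrow> 'b) \<Rightarrow> bool" where
  "periodic f \<longleftrightarrow> (\<forall>b\<in>Basis. \<forall>x. f (x + b) = f x)"

definition spacetime :: "real \<Rightarrow> (real \<times> (real ^ 'd)) set" where
  "spacetime T = {0<..<T} \<times> unit_cell"

primrec C_k :: "nat \<Rightarrow> ('a::euclidean_space \<Rightarrow> 'b::real_normed_vector) \<Rightarrow> bool" where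
  "C_k 0 f \<longleftrightarrow> continuous_on UNIV f"
| "C_k (Suc k) f \<longleftrightarrow>
     f differentiable_on UNIV \<and> (\<forall>b\<in>Basis. C_k k (\<lambda>x. frechet_derivative f (at x) b))"

definition smooth :: "('a::euclidean_space \<Rightarrow> 'b::real_normed_vector) \<Rightarrow> bool" where
  "smooth f \<longleftrightarrow> (\<forall>k. C_k k f)"

definition grad :: "((real ^ 'd) \<Rightarrow> real) \<Rightarrow> (real ^ 'd) \<Rightarrow> (real ^ 'd)" where
  "grad \<psi> x = (\<chi> j. frechet_derivative \<psi> (at x) (axis j 1))"

definition D_t :: "(real \<times> (real ^ 'd) \<Rightarrow> 'b::real_normed_vector) \<Rightarrow> real \<times> (real ^ 'd) \<Rightarrow> 'b" where
  "D_t f z = frechet_derivative f (at z) (1, 0)"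

definition D_x :: "'d \<Rightarrow> (real \<times> (real ^ 'd) \<Rightarrow> 'b::real_normed_vector) \<Rightarrow> real \<times> (real ^ 'd) \<Rightarrow> 'b" where
  "D_x j f z = frechet_derivative f (at z) (0, axis j 1)"

definition grad_x :: "(real \<times> (real ^ 'd) \<Rightarrow> (real ^ 'd)) \<Rightarrow> real \<times> (real ^ 'd) \<Rightarrow> (real ^ 'd ^ 'd)" where
  "grad_x \<phi> z = (\<chi> i j. D_x j \<phi> z $ i)"

definition div_x :: "(real \<times> (real ^ 'd) \<Rightarrow> (real ^ 'd)) \<Rightarrow> real \<times> (real ^ 'd) \<Rightarrow> real" where
  "div_x \<phi> z = (\<Sum>i\<in>UNIV. D_x i \<phi> z $ i)"

definition tensor :: "(real ^ 'd) \<Rightarrow> (real ^ 'd) \<Rightarrow> (real ^ 'd ^ 'd)" where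
  "tensor u v = (\<chi> i j. u $ i * v $ j)"

text \<open>
  \<open>test_fields T\<close> is the space of compactly supported smooth fields on \<open>[0, T) \<times> T\<^sup>d\<close>: the
  initial time is included, so a field need not vanish there, and smoothness up to \<open>t = 0\<close> is
  expressed by a smooth extension to negative times (whose values there play no role).
\<close>

definition test_fields :: "real \<Rightarrow> (real \<times> (real ^ 'd) \<Rightarrow> (real ^ 'd)) set" where
  "test_fields T = {\<phi>. smooth \<phi> \<and> (\<forall>t. periodic (\<lambda>x. \<phi> (t, x))) \<and>
     (\<exists>T'<T. \<forall>t\<ge>T'. \<forall>x. \<phi> (t, x) = 0)}"

definition young_measure ::
    "real \<Rightarrow> (real \<times> (real ^ 'd) \<Rightarrow> 'a::euclidean_space measure) \<Rightarrow> bool" where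
  "young_measure T \<mu> \<longleftrightarrow>
     (\<forall>z\<in>spacetime T. prob_space (\<mu> z) \<and> sets (\<mu> z) = sets borel) \<and>
     (\<forall>f :: 'a \<Rightarrow> real. continuous_on UNIV f \<and> (f \<longlongrightarrow> 0) at_infinity \<longrightarrow>
        (\<lambda>z. integral\<^sup>L (\<mu> z) f) \<in> borel_measurable (lebesgue_on (spacetime T)))"

text \<open>
  The Bochner integral of a non-integrable function is 0, hence the existence of the integrals
  in the momentum equation is demanded explicitly. The second moment is stated as an integral in
  \<open>[0, \<infinity>]\<close>; its boundedness makes \<open>u\<close> and \<open>u \<otimes> u\<close> integrable with respect to almost every
  \<open>\<mu> z\<close>.
\<close>

definition augmented_mv_solution ::
    "real \<Rightarrow> ((real ^ 'd) \<Rightarrow> (real ^ 'd)) \<Rightarrow> (real \<times> (real ^ 'd) \<Rightarrow> ((real ^ 'd) \<times> real) measure) \<Rightarrow> bool"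
where
  "augmented_mv_solution T u\<^sub>0 \<mu> \<longleftrightarrow>
     integrable (lebesgue_on unit_cell) u\<^sub>0 \<and>
     young_measure T \<mu> \<and>
     (\<exists>C::real. AE z in lebesgue_on (spacetime T).
        (\<integral>\<^sup>+(u, P). ennreal ((norm u)\<^sup>2) \<partial>\<mu> z) \<le> ennreal C) \<and>
     (AE z in lebesgue_on (spacetime T). integrable (\<mu> z) (\<lambda>(u, P). P)) \<and>
     (\<forall>\<phi>\<in>test_fields T.
        let F = (\<lambda>z. D_t \<phi> z \<bullet> (\<integral>(u, P). u \<partial>\<mu> z)
                   + grad_x \<phi> z \<bullet> (\<integral>(u, P). tensor u u \<partial>\<mu> z)
                   + (\<integral>(u, P). P \<partial>\<mu> z) * div_x \<phi> z)
        in integrable (lebesgue_on (spacetime T)) F \<and>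
           integral\<^sup>L (lebesgue_on (spacetime T)) F
             = - (\<integral>x. \<phi> (0, x) \<bullet> u\<^sub>0 x \<partial>lebesgue_on unit_cell)) \<and>
     (\<forall>\<psi>. smooth \<psi> \<and> periodic \<psi> \<longrightarrow>
        (AE t in lebesgue_on {0<..<T}.
           (\<integral>x. grad \<psi> x \<bullet> (\<integral>(u, P). u \<partial>\<mu> (t, x)) \<partial>lebesgue_on unit_cell) = 0))"

definition weak_solution ::
    "real \<Rightarrow> ((real ^ 'd) \<Rightarrow> (real ^ 'd)) \<Rightarrow> (real \<times> (real ^ 'd) \<Rightarrow> (real ^ 'd)) \<Rightarrow> (real \<times> (real ^ 'd) \<Rightarrow> real) \<Rightarrow> bool"
where
  "weak_solution T u\<^sub>0 u P \<longleftrightarrow>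
     integrable (lebesgue_on (spacetime T)) u \<and>
     integrable (lebesgue_on (spacetime T)) P \<and>
     augmented_mv_solution T u\<^sub>0 (\<lambda>z. return borel (u z, P z))"

definition convex_comb :: "real \<Rightarrow> 'a measure \<Rightarrow> 'a measure \<Rightarrow> 'a measure" where
  "convex_comb l M N =
     measure_of (space M) (sets M) (\<lambda>A. ennreal l * emeasure M A + ennreal (1 - l) * emeasure N A)"

text \<open>
  \<open>states\<close> is the space \<open>\<real> \<times> \<real>\<^sup>d \<times> S\<^sub>0\<^sup>d \<times> \<real> \<cong> \<real>\<^sup>N\<close>, a linear subspace of the type \<open>'d state\<close>.
  Functions on it are constrained on \<open>states\<close> only, so lifted measures live on
  \<open>restrict_space borel states\<close>.
\<close>

type_synonym 'd state = "real \<times> (real ^ 'd) \<times> (real ^ 'd ^ 'd) \<times> real"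

definition states :: "'d::finite state set" where
  "states = {(\<rho>, m, M, Q). transpose M = M \<and> trace M = 0}"

definition lift :: "(real ^ 'd) \<times> real \<Rightarrow> 'd::finite state" where
  "lift = (\<lambda>(u, P). (1, u,
     tensor u u - ((norm u)\<^sup>2 / real CARD('d)) *\<^sub>R mat 1,
     P + (norm u)\<^sup>2 / real CARD('d)))"

definition push_lift :: "((real ^ 'd) \<times> real) measure \<Rightarrow> 'd::finite state measure" where
  "push_lift \<mu> = distr \<mu> (restrict_space borel states) lift"

definition euler_op :: "(real \<times> (real ^ 'd) \<Rightarrow> 'd::finite state) \<Rightarrow> real \<times> (real ^ 'd) \<Rightarrow> (real ^ 'd) \<times> real" where
  "euler_op w y =
     (let \<rho> = (\<lambda>y. case w y of (\<rho>, m, M, Q) \<Rightarrow> \<rho>);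
          m = (\<lambda>y. case w y of (\<rho>, m, M, Q) \<Rightarrow> m);
          M = (\<lambda>y. case w y of (\<rho>, m, M, Q) \<Rightarrow> M);
          Q = (\<lambda>y. case w y of (\<rho>, m, M, Q) \<Rightarrow> Q)
      in (\<chi> i. D_t m y $ i + (\<Sum>j\<in>UNIV. D_x j M y $ i $ j) + D_x i Q y,
          D_t \<rho> y + (\<Sum>i\<in>UNIV. D_x i m y $ i)))"

definition euler_envelope :: "('d::finite state \<Rightarrow> real) \<Rightarrow> 'd state \<Rightarrow> ereal" where
  "euler_envelope f z =
     Inf {ereal (\<integral>y. f (z + \<phi> y) \<partial>lebesgue_on unit_cell) | \<phi> :: real \<times> (real ^ 'd) \<Rightarrow> 'd state.
       smooth \<phi> \<and> periodic \<phi> \<and> range \<phi> \<subseteq> states \<and> (\<forall>y. euler_op \<phi> y = 0) \<and>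
       (\<integral>y. \<phi> y \<partial>lebesgue_on unit_cell) = 0}"

text \<open>
  The exceptional null set does not depend on \<open>f\<close>. The condition is intended for Young measures
  against whose lifts every continuous \<open>f\<close> is integrable, for instance compactly supported ones.
\<close>

definition jensen_condition :: "real \<Rightarrow> (real \<times> (real ^ 'd::finite) \<Rightarrow> ((real ^ 'd) \<times> real) measure) \<Rightarrow> bool" where
  "jensen_condition T \<nu> \<longleftrightarrow>
     (AE z in lebesgue_on (spacetime T). \<forall>f. continuous_on states f \<longrightarrow>
        ereal (\<integral>w. f w \<partial>push_lift (\<nu> z)) \<ge> euler_envelope f (\<integral>w. w \<partial>push_lift (\<nu> z)))"

end

(*
  At a point z the lifted measure is l delta_{z1} + (1-l) delta_{z2}, so the Jensen inequality is a
  condition on U = z1 - z2. The symbol of the operator at (tau, k) sends U to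
  ((tau + u1.k) (u1-u2) + ((u1-u2).k) u2 + (P1-P2) k, k.(u1-u2)), which vanishes for some
  (tau, k) <> 0 exactly if u1 = u2 or P1 = P2 (d = 2 provides k orthogonal to u1-u2).

  On the wave cone, oscillations between z1 and z2 in the direction (tau, k) realise the two-point
  average. The direction need not be rational, hence not compatible with the period cell; but U is
  a limit of lift differences of states with rational velocities, whose directions are rational.

  Off the wave cone, split a field as w = chi U + r. The equation A w = 0 expresses the gradient of
  chi by first derivatives of r, so the L2 norm of chi is at most C times that of r. The quadratic
  form C |r|^2 - chi^2 is therefore quasiconvex, but negative at U, and it violates the inequality.
*)

theory Submission
  imports Defs "HOL-Complex_Analysis.Cauchy_Integral_Formula" "HOL-Real_Asymp.Real_Asymp"
begin

section \<open>Integration over the torus\<close>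

text \<open>A competitor in the envelope is smooth, periodic and of mean zero, which excludes both a
  jump between two values and an irrational direction. Both are approximated, and only the
  oscillating part is changed: the barycentre stays exactly where the envelope is evaluated, so no
  continuity of the envelope in its argument is needed. The rational perturbation acts on the
  velocities and keeps the common pressure. Perturbing the difference of the states freely could
  leave the wave cone, while lifts with equal pressure always differ by an element of it. Off the
  cone, bounding chi by r is a multiplier estimate of order zero. It is proved by testing with
  trigonometric polynomials, for which the Poisson equation and all integrations by parts are
  explicit. In place of C |r|^2 the quadratic form carries the squared coordinates of the inverted
  symbol applied to r; the estimate then holds with constant one and no C has to be found. Both
  directions are settled at each single point, so the almost-everywhere quantifier never interacts
  with the choice of f.\<close>

abbreviation torus :: "'a::euclidean_space measure" where
  "torus \<equiv> lebesgue_on unit_cell"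

lemma unit_cell_borel [measurable]: "unit_cell \<in> sets borel"
proof -
  have "unit_cell = (\<Inter>b\<in>Basis. {x::'a. 0 \<le> x \<bullet> b} \<inter> {x. x \<bullet> b < 1})"
    by (auto simp: unit_cell_def)
  also have "\<dots> \<in> sets borel"
    by (intro sets.finite_INT) auto
  finally show ?thesis .
qed

lemma unit_cell_lebesgue [measurable]: "unit_cell \<in> sets lebesgue"
  by (simp add: sets_completionI_sets)

lemma unit_cell_bounds:
  "box 0 One \<subseteq> (unit_cell :: 'a::euclidean_space set)"
  "(unit_cell :: 'a::euclidean_space set) \<subseteq> cbox 0 One"
  by (auto simp: unit_cell_def mem_box) (force intro: less_imp_le)+

lemma emeasure_unit_cell: "emeasure lebesgue (unit_cell :: 'a::euclidean_space set) = 1"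
proof (rule antisym)
  have "emeasure lebesgue (unit_cell :: 'a set) \<le> emeasure lebesgue (cbox 0 One :: 'a set)"
    by (intro emeasure_mono unit_cell_bounds) auto
  thus "emeasure lebesgue (unit_cell :: 'a set) \<le> 1"
    by (simp add: emeasure_lborel_cbox_eq)
  have "emeasure lebesgue (box 0 One :: 'a set) \<le> emeasure lebesgue (unit_cell :: 'a set)"
    by (intro emeasure_mono unit_cell_bounds) auto
  thus "1 \<le> emeasure lebesgue (unit_cell :: 'a set)"
    by (simp add: emeasure_lborel_box_eq)
qed

interpretation torus: prob_space "torus :: 'a::euclidean_space measure"
  by standard (simp add: emeasure_restrict_space emeasure_unit_cell)

lemma measure_torus_unit_cell [simp]: "measure torus (unit_cell :: 'a::euclidean_space set) = 1"
  using torus.prob_space by simp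

lemma borel_measurable_torus:
  "f \<in> borel_measurable borel \<Longrightarrow> f \<in> borel_measurable torus"
  by (simp add: measurable_completion measurable_restrict_space1)

lemma continuous_integrable_torus:
  fixes f :: "'a::euclidean_space \<Rightarrow> 'b::euclidean_space"
  assumes "continuous_on UNIV f"
  shows "integrable torus f"
proof -
  have "compact (f ` cbox 0 One)"
    by (intro compact_continuous_image continuous_on_subset[OF assms]) auto
  then obtain B where B: "\<And>x. x \<in> cbox 0 One \<Longrightarrow> norm (f x) \<le> B"
    using compact_imp_bounded by (metis bounded_iff imageI)
  show ?thesis
  proof (rule torus.integrable_const_bound[of _ B])
    show "AE x in torus. norm (f x) \<le> B"
      using B unit_cell_bounds by (intro AE_I2) (auto simp: )
    show "f \<in> borel_measurable torus"
      by (intro borel_measurable_torus borel_measurable_continuous_onI assms)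
  qed
qed

lemma integral_torus_eq:
  fixes f :: "'a::euclidean_space \<Rightarrow> real"
  assumes [measurable]: "f \<in> borel_measurable borel"
  shows "integral\<^sup>L torus f = (\<integral>x. indicator unit_cell x * f x \<partial>lborel)"
  by (subst integral_restrict_space) (auto simp: integral_completion)

lemma lborel_integral_translation:
  fixes f :: "'a::euclidean_space \<Rightarrow> real"
  assumes [measurable]: "f \<in> borel_measurable borel"
  shows "(\<integral>x. f (x + c) \<partial>lborel) = (\<integral>x. f x \<partial>lborel)"
  by (subst (2) lborel_distr_plus[of c, symmetric], subst integral_distr) (auto simp: add.commute)

lemma lborel_integrable_translation:
  fixes f :: "'a::euclidean_space \<Rightarrow> real"
  assumes "integrable lborel f"
  shows "integrable lborel (\<lambda>x. f (x + c))"
proof -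
  have "integrable (distr lborel borel ((+) c)) f"
    using assms by (simp add: lborel_distr_plus)
  thus ?thesis
    by (subst (asm) integrable_distr_eq) (use assms in \<open>auto simp: add.commute\<close>)
qed

text \<open>A translation by at most one period pushes a single slab of the cell out through one
  face, and periodicity carries it back to the opposite face.\<close>

lemma integral_torus_translation:
  fixes f :: "'a::euclidean_space \<Rightarrow> real"
  assumes f: "continuous_on UNIV f" and per: "periodic f" and b: "b \<in> Basis" and t: "0 \<le> t" "t \<le> 1"
  shows "(\<integral>y. f (y + t *\<^sub>R b) \<partial>torus) = (\<integral>y. f y \<partial>torus)"
proof -
  have [measurable]: "f \<in> borel_measurable borel"
    by (intro borel_measurable_continuous_onI f)
  let ?A = "unit_cell \<inter> {y. y \<bullet> b \<ge> t}" and ?B = "unit_cell \<inter> {y. y \<bullet> b < t}"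
  have int: "integrable lborel (\<lambda>y. indicator D y * f y)" if D: "D \<in> sets borel" "D \<subseteq> unit_cell" for D
  proof -
    have "integrable torus (\<lambda>y. indicator D y * f y)"
      using D continuous_integrable_torus[OF f]
      by (intro integrable_mult_indicator[where 'b=real, simplified])
         (auto simp: sets_restrict_space_iff sets_completionI_sets)
    hence "integrable lebesgue (\<lambda>y. indicator unit_cell y * (indicator D y * f y))"
      by (subst (asm) integrable_restrict_space) auto
    also have "(\<lambda>y. indicator unit_cell y * (indicator D y * f y)) = (\<lambda>y. indicator D y * f y)"
      using D by (auto simp: indicator_def fun_eq_iff)
    finally show ?thesis
      using D by (subst (asm) integrable_completion) auto
  qed
  have cell: "y \<in> unit_cell \<longleftrightarrow> 0 \<le> y \<bullet> b \<and> y \<bullet> b < 1 \<and> (\<forall>c\<in>Basis - {b}. 0 \<le> y \<bullet> c \<and> y \<bullet> c < 1)" for y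
    using b by (auto simp: unit_cell_def)
  have other: "(y - s *\<^sub>R b) \<bullet> c = y \<bullet> c" if "c \<in> Basis - {b}" for y s c
    using b that by (auto simp: inner_diff_left inner_Basis)
  \<comment> \<open>The translated cell is \<open>?A\<close> together with \<open>?B\<close> moved
    by \<open>b\<close>: the slab missing at one end reappears one period further.\<close>
  have split: "indicator unit_cell (y - t *\<^sub>R b) = indicator ?A y + (indicator ?B (y - b) :: real)" for y
    using b t other[of _ y 1] other[of _ y t]
    by (auto simp: cell inner_diff_left inner_Basis split: split_indicator)
  have "(\<integral>y. f (y + t *\<^sub>R b) \<partial>torus) = (\<integral>y. indicator unit_cell y * f (y + t *\<^sub>R b) \<partial>lborel)"
    by (rule integral_torus_eq) measurable
  also have "\<dots> = (\<integral>y. (\<lambda>y. indicator unit_cell (y - t *\<^sub>R b) * f y) (y + t *\<^sub>R b) \<partial>lborel)"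
    by simp
  also have "\<dots> = (\<integral>y. indicator unit_cell (y - t *\<^sub>R b) * f y \<partial>lborel)"
    by (rule lborel_integral_translation) measurable
  also have "\<dots> = (\<integral>y. indicator ?A y * f y + (\<lambda>y. indicator ?B (y - b) * f y) y \<partial>lborel)"
    by (simp only: split distrib_right)
  also have "\<dots> = (\<integral>y. indicator ?A y * f y \<partial>lborel) + (\<integral>y. indicator ?B (y - b) * f y \<partial>lborel)"
  proof (rule Bochner_Integration.integral_add)
    have "integrable lborel (\<lambda>y. (\<lambda>y. indicator ?B y * f y) (y + - b))"
      by (rule lborel_integrable_translation, rule int) auto
    moreover have "f (y - b) = f y" for y
      using per b by (metis periodic_def diff_add_cancel)
    ultimately show "integrable lborel (\<lambda>y. indicator ?B (y - b) * f y)"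
      by simp
  qed (rule int; measurable)
  also have "(\<integral>y. indicator ?B (y - b) * f y \<partial>lborel) = (\<integral>y. (\<lambda>y. indicator ?B (y - b) * f y) (y + b) \<partial>lborel)"
    by (rule lborel_integral_translation[symmetric]) measurable
  also have "\<dots> = (\<integral>y. indicator ?B y * f y \<partial>lborel)"
    using per b by (simp add: periodic_def)
  also have "(\<integral>y. indicator ?A y * f y \<partial>lborel) + \<dots> = (\<integral>y. indicator ?A y * f y + indicator ?B y * f y \<partial>lborel)"
    by (rule Bochner_Integration.integral_add[symmetric]; rule int; measurable)
  also have "\<dots> = (\<integral>y. indicator unit_cell y * f y \<partial>lborel)"
    by (intro Bochner_Integration.integral_cong) (auto simp: indicator_def)
  also have "\<dots> = (\<integral>y. f y \<partial>torus)"
    by (rule integral_torus_eq[symmetric]) measurable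
  finally show ?thesis .
qed

lemma integral_torus_Fubini:
  fixes f :: "'a::euclidean_space \<Rightarrow> 'b::euclidean_space \<Rightarrow> real"
  assumes f: "continuous_on UNIV (\<lambda>(x, y). f x y)"
  shows "(\<integral>x. (\<integral>y. f x y \<partial>torus) \<partial>torus) = (\<integral>y. (\<integral>x. f x y \<partial>torus) \<partial>torus)"
proof -
  let ?M = "(torus :: 'a measure) \<Otimes>\<^sub>M (torus :: 'b measure)"
  interpret P: pair_prob_space "torus :: 'a measure" "torus :: 'b measure" ..
  have "compact ((\<lambda>(x, y). f x y) ` (cbox 0 One \<times> cbox 0 One))"
    by (intro compact_continuous_image continuous_on_subset[OF f] compact_Times) auto
  then obtain B where B: "\<And>x y. x \<in> cbox 0 One \<Longrightarrow> y \<in> cbox 0 One \<Longrightarrow> \<bar>f x y\<bar> \<le> B"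
    by (force dest!: compact_imp_bounded simp: bounded_iff)
  have id: "(\<lambda>x. x) \<in> measurable torus borel"
    by (intro borel_measurable_torus) simp
  have "(\<lambda>(x, y). f x y) \<in> borel_measurable (borel \<Otimes>\<^sub>M borel)"
    using borel_measurable_continuous_onI[OF f] by (simp add: borel_prod)
  moreover have "(\<lambda>p. (fst p, snd p)) \<in> measurable ?M (borel \<Otimes>\<^sub>M borel)"
    by (intro measurable_Pair measurable_compose[OF measurable_fst id] measurable_compose[OF measurable_snd id])
  ultimately have meas: "(\<lambda>(x, y). f x y) \<in> borel_measurable ?M"
    using measurable_compose by fastforce
  have "integrable ?M (\<lambda>(x, y). f x y)"
  proof (rule P.P.integrable_const_bound[of _ B])
    show "AE p in ?M. norm (case p of (x, y) \<Rightarrow> f x y) \<le> B"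
      by (intro AE_I2) (auto simp: space_pair_measure intro!: B subsetD[OF unit_cell_bounds(2)])
  qed (rule meas)
  from P.Fubini_integral[OF this] show ?thesis by simp
qed

lemma unit_cell_real: "(unit_cell :: real set) = {0..<1}"
  by (auto simp: unit_cell_def)

lemma integral_torus_real:
  fixes f :: "real \<Rightarrow> real"
  assumes f: "continuous_on UNIV f"
  shows "integral\<^sup>L torus f = integral {0..1} f"
proof -
  have [measurable]: "f \<in> borel_measurable borel"
    by (intro borel_measurable_continuous_onI f)
  have "integral\<^sup>L torus f = (\<integral>x. indicator unit_cell x * f x \<partial>lborel)"
    by (rule integral_torus_eq) measurable
  also have "\<dots> = (\<integral>x. indicator {0..1} x * f x \<partial>lborel)"
    by (intro integral_cong_AE eventually_mono[OF AE_lborel_singleton[of 1]])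
       (auto simp: unit_cell_real split: split_indicator)
  also have "\<dots> = integral {0..1} f"
    using set_borel_integral_eq_integral(2)[OF borel_integrable_atLeastAtMost'[OF continuous_on_subset[OF f]], of 0 1]
    by (simp add: set_lebesgue_integral_def)
  finally show ?thesis .
qed

lemma periodic_int_shift:
  assumes "periodic f" "b \<in> Basis"
  shows "f (x + of_int n *\<^sub>R b) = f x"
proof -
  have *: "f (x + real n *\<^sub>R b) = f x" for n x
  proof (induction n)
    case (Suc n)
    have "f (x + real (Suc n) *\<^sub>R b) = f ((x + real n *\<^sub>R b) + b)"
      by (simp add: algebra_simps)
    thus ?case using assms Suc by (simp add: periodic_def)
  qed simp
  show ?thesis
  proof (cases "n \<ge> 0")
    case True
    thus ?thesis using *[of x "nat n"] by simp
  next
    case False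
    thus ?thesis using *[of "x + of_int n *\<^sub>R b" "nat (-n)"] by simp
  qed
qed

text \<open>
  By translation invariance the integral of \<open>F (\<xi> \<bullet> y + s)\<close> does not depend on \<open>s\<close>, so it may be
  averaged over a period in \<open>s\<close>.
\<close>

lemma integral_torus_plane_wave:
  fixes F :: "real \<Rightarrow> real" and \<xi> :: "'a::euclidean_space"
  assumes F: "continuous_on UNIV F" and per: "periodic F"
    and \<xi>: "\<And>b. b \<in> Basis \<Longrightarrow> \<xi> \<bullet> b \<in> \<int>" "\<xi> \<noteq> 0"
  shows "(\<integral>y. F (\<xi> \<bullet> y) \<partial>torus) = integral {0..1} F"
proof -
  have perZ: "F (x + of_int n) = F x" for x n
    using periodic_int_shift[OF per, of 1 x n] by simp
  obtain b where b: "b \<in> Basis" "\<xi> \<bullet> b \<noteq> 0"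
    using \<xi>(2) by (metis euclidean_eq_iff inner_zero_left)
  obtain m where m: "\<xi> \<bullet> b = of_int m"
    using \<xi>(1)[OF b(1)] Ints_cases by blast
  have cont: "continuous_on UNIV (\<lambda>y. F (\<xi> \<bullet> y + s))" for s
    by (intro continuous_on_compose2[OF F]) (auto intro!: continuous_intros)
  have perw: "periodic (\<lambda>y. F (\<xi> \<bullet> y + s))" for s
    unfolding periodic_def
  proof safe
    fix c x :: 'a assume "c \<in> Basis"
    then obtain k where k: "\<xi> \<bullet> c = of_int k"
      using \<xi>(1) Ints_cases by blast
    show "F (\<xi> \<bullet> (x + c) + s) = F (\<xi> \<bullet> x + s)"
      using perZ[of "\<xi> \<bullet> x + s" k] by (simp add: inner_add_right k algebra_simps)
  qed
  define I where "I = (\<lambda>s. \<integral>y. F (\<xi> \<bullet> y + s) \<partial>torus)"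
  have trans: "I (s + of_int m * t) = I s" if "0 \<le> t" "t \<le> 1" for s t
    using integral_torus_translation[OF cont perw b(1) that, of s] m
    by (simp add: I_def inner_add_right algebra_simps inner_commute)
  \<comment> \<open>Moving y along \<open>b\<close> by s / m changes the phase by s. For negative m
    the move starts at phase s and ends at 0, because \<open>trans\<close> admits only nonnegative
    steps.\<close>
  have I: "I s = I 0" if "s \<in> unit_cell" for s
  proof (cases "m > 0")
    case True
    hence "1 \<le> real_of_int m" by simp
    thus ?thesis using trans[of "s / m" 0] that True
      by (auto simp: unit_cell_real divide_simps)
  next
    case False
    hence "real_of_int m \<le> -1" using b m by auto
    thus ?thesis using trans[of "- s / m" s] that
      by (auto simp: unit_cell_real divide_simps)
  qed
  \<comment> \<open>The offset is reduced to its fractional part, since translation invariance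
    covers shifts between 0 and 1 only.\<close>
  have inner: "(\<integral>s. F (c + s) \<partial>torus) = (\<integral>s. F s \<partial>torus)" for c
  proof -
    have "F (c + s) = F (s + frac c *\<^sub>R 1)" for s
      using perZ[of "s + frac c" "\<lfloor>c\<rfloor>"] by (simp add: frac_def algebra_simps)
    thus ?thesis
      using integral_torus_translation[OF F per, of 1 "frac c"] frac_lt_1[of c]
      by (simp add: less_imp_le)
  qed
  have "(\<integral>y. F (\<xi> \<bullet> y) \<partial>torus) = (\<integral>s. I 0 \<partial>(torus :: real measure))"
    by (simp add: I_def )
  also have "\<dots> = (\<integral>s. I s \<partial>torus)"
    by (intro Bochner_Integration.integral_cong) (auto simp: I)
  also have "\<dots> = (\<integral>y. (\<integral>s. F (\<xi> \<bullet> y + s) \<partial>torus) \<partial>torus)"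
    unfolding I_def
    by (intro integral_torus_Fubini)
       (auto simp: case_prod_unfold intro!: continuous_on_compose2[OF F] continuous_intros)
  also have "\<dots> = (\<integral>s. F s \<partial>torus)"
    by (simp add: inner )
  finally show ?thesis by (simp add: integral_torus_real F)
qed

section \<open>Directional derivatives and integration by parts on the torus\<close>

definition has_dir_deriv :: "'a::real_normed_vector \<Rightarrow> ('a \<Rightarrow> real) \<Rightarrow> ('a \<Rightarrow> real) \<Rightarrow> bool" where
  "has_dir_deriv b f f' \<longleftrightarrow> (\<forall>y. ((\<lambda>t. f (y + t *\<^sub>R b)) has_real_derivative f' y) (at 0))"

lemma has_dir_deriv_at:
  assumes "has_dir_deriv b f f'"
  shows "((\<lambda>t. f (y + t *\<^sub>R b)) has_real_derivative f' (y + s *\<^sub>R b)) (at s)"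
proof -
  have "((\<lambda>t. f ((y + s *\<^sub>R b) + t *\<^sub>R b)) has_real_derivative f' (y + s *\<^sub>R b)) (at 0)"
    using assms by (simp add: has_dir_deriv_def)
  hence "((\<lambda>t. f (y + (t + s) *\<^sub>R b)) has_real_derivative f' (y + s *\<^sub>R b)) (at 0)"
    by (simp add: algebra_simps)
  thus ?thesis
    using DERIV_shift[of "\<lambda>t. f (y + t *\<^sub>R b)" _ 0 s] by simp
qed


lemma has_dir_deriv_add:
  "has_dir_deriv b f f' \<Longrightarrow> has_dir_deriv b g g' \<Longrightarrow> has_dir_deriv b (\<lambda>y. f y + g y) (\<lambda>y. f' y + g' y)"
  unfolding has_dir_deriv_def by (auto intro!: DERIV_add)

lemma has_dir_deriv_mult:
  "has_dir_deriv b f f' \<Longrightarrow> has_dir_deriv b g g' \<Longrightarrow>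
     has_dir_deriv b (\<lambda>y. f y * g y) (\<lambda>y. f' y * g y + f y * g' y)"
  unfolding has_dir_deriv_def by (auto intro!: derivative_eq_intros)

text \<open>Connects vector-valued fields with the scalar integration by parts: \<open>L\<close>
  will be a linear functional on the state space.\<close>

lemma has_derivative_has_dir_deriv:
  fixes f :: "'a::real_normed_vector \<Rightarrow> 'b::real_normed_vector" and L :: "'b \<Rightarrow> real"
  assumes "f differentiable_on UNIV" "bounded_linear L"
  shows "has_dir_deriv b (\<lambda>y. L (f y)) (\<lambda>y. L (frechet_derivative f (at y) b))"
  unfolding has_dir_deriv_def
proof
  fix y
  define D where "D = frechet_derivative f (at y)"
  have "(f has_derivative D) (at y)"
    using assms by (simp add: D_def differentiable_on_def frechet_derivative_works)
  hence "((\<lambda>t. f (y + t *\<^sub>R b)) has_derivative (\<lambda>t. D (t *\<^sub>R b))) (at 0)"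
    by (intro has_derivative_compose[where g = f and g' = D and f = "\<lambda>t. y + t *\<^sub>R b"])
       (auto intro!: derivative_eq_intros)
  from bounded_linear.has_derivative[OF assms(2) this]
  have "((\<lambda>t. L (f (y + t *\<^sub>R b))) has_derivative (\<lambda>t. L (D (t *\<^sub>R b)))) (at 0)" .
  moreover have "linear D"
    using \<open>(f has_derivative D) (at y)\<close> has_derivative_linear by blast
  ultimately show "((\<lambda>t. L (f (y + t *\<^sub>R b))) has_real_derivative L (D b)) (at 0)"
    using assms(2)
    by (simp add: has_field_derivative_def linear_cmul bounded_linear.linear mult.commute[of _ "L (D b)"])
qed

text \<open>Averaging over all translates along \<open>b\<close> does not change the integral. After
  Fubini the inner integral runs over a full period of a derivative, and the fundamental theorem
  makes it vanish.\<close>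

lemma integral_torus_dir_deriv:
  fixes f :: "'a::euclidean_space \<Rightarrow> real"
  assumes b: "b \<in> Basis" and per: "periodic f" and d: "has_dir_deriv b f f'" and c: "continuous_on UNIV f'"
  shows "(\<integral>y. f' y \<partial>torus) = 0"
proof -
  \<comment> \<open>Translation invariance is applied to \<open>f'\<close>, whose periodicity
    follows from that of \<open>f\<close> by uniqueness of derivatives.\<close>
  have per': "periodic f'"
    unfolding periodic_def
  proof safe
    fix c x :: 'a assume c: "c \<in> Basis"
    have "f (x + c + t *\<^sub>R b) = f (x + t *\<^sub>R b)" for t
      using per c by (metis periodic_def add.assoc add.commute)
    thus "f' (x + c) = f' x"
      using d unfolding has_dir_deriv_def by (metis (no_types, lifting) DERIV_cong_ev DERIV_unique ext)
  qed
  have inner: "(\<integral>t. f' (y + t *\<^sub>R b) \<partial>torus) = 0" for y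
  proof -
    have "(\<integral>t. f' (y + t *\<^sub>R b) \<partial>torus) = integral {0..1} (\<lambda>t. f' (y + t *\<^sub>R b))"
      by (intro integral_torus_real continuous_on_compose2[OF c]) (auto intro!: continuous_intros)
    moreover have "((\<lambda>t. f' (y + t *\<^sub>R b)) has_integral (f (y + 1 *\<^sub>R b) - f (y + 0 *\<^sub>R b))) {0..1}"
      using has_dir_deriv_at[OF d]
      by (intro fundamental_theorem_of_calculus)
         (auto simp: has_real_derivative_iff_has_vector_derivative[symmetric] intro: has_field_derivative_at_within)
    hence "integral {0..1} (\<lambda>t. f' (y + t *\<^sub>R b)) = 0"
      using per b by (auto simp: periodic_def dest: integral_unique)
    ultimately show ?thesis by simp
  qed
  have "(\<integral>y. f' y \<partial>torus) = (\<integral>t. (\<integral>y. f' y \<partial>torus) \<partial>(torus :: real measure))"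
    by (simp add: )
  also have "\<dots> = (\<integral>t. (\<integral>y. f' (y + t *\<^sub>R b) \<partial>torus) \<partial>torus)"
    by (intro Bochner_Integration.integral_cong refl integral_torus_translation[OF c per' b, symmetric])
       (auto simp: unit_cell_real)
  also have "\<dots> = (\<integral>y. (\<integral>t. f' (y + t *\<^sub>R b) \<partial>torus) \<partial>torus)"
    by (intro integral_torus_Fubini)
       (auto simp: case_prod_unfold intro!: continuous_on_compose2[OF c] continuous_intros)
  finally show ?thesis by (simp add: inner)
qed

lemma integral_torus_by_parts:
  fixes f g :: "'a::euclidean_space \<Rightarrow> real"
  assumes "b \<in> Basis" "periodic f" "periodic g" "has_dir_deriv b f f'" "has_dir_deriv b g g'"
    and c: "continuous_on UNIV f" "continuous_on UNIV g" "continuous_on UNIV f'" "continuous_on UNIV g'"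
  shows "(\<integral>y. f' y * g y \<partial>torus) = - (\<integral>y. f y * g' y \<partial>torus)"
proof -
  have "(\<integral>y. f' y * g y + f y * g' y \<partial>torus) = 0"
    using assms
    by (intro integral_torus_dir_deriv[of b "\<lambda>y. f y * g y"] has_dir_deriv_mult)
       (auto simp: periodic_def intro!: continuous_intros)
  moreover have "(\<integral>y. f' y * g y + f y * g' y \<partial>torus) = (\<integral>y. f' y * g y \<partial>torus) + (\<integral>y. f y * g' y \<partial>torus)"
    using c by (intro Bochner_Integration.integral_add continuous_integrable_torus continuous_intros)
  ultimately show ?thesis by simp
qed

section \<open>Trigonometric polynomials\<close>

text \<open>The operator form of \<open>has_dir_deriv\<close>, so that derivatives can be iterated
  in Hessians and Laplacians.\<close>

definition dir_deriv :: "'a::real_normed_vector \<Rightarrow> ('a \<Rightarrow> real) \<Rightarrow> 'a \<Rightarrow> real" where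
  "dir_deriv b f y = deriv (\<lambda>t. f (y + t *\<^sub>R b)) 0"

lemma dir_deriv_eqI: "has_dir_deriv b f f' \<Longrightarrow> dir_deriv b f = f'"
  by (auto simp: has_dir_deriv_def dir_deriv_def fun_eq_iff intro: DERIV_imp_deriv)

text \<open>A cosine with a phase replaces the pair of cosine and sine: the derivative of a wave is
  then again one wave, with the phase advanced by pi / 2.\<close>

inductive trig_poly :: "('a::euclidean_space \<Rightarrow> real) \<Rightarrow> bool" where
  wave: "(\<And>b. b \<in> Basis \<Longrightarrow> \<xi> \<bullet> b \<in> \<int>) \<Longrightarrow> trig_poly (\<lambda>y. r * cos (2 * pi * (\<xi> \<bullet> y) + \<delta>))"
| add: "trig_poly p \<Longrightarrow> trig_poly q \<Longrightarrow> trig_poly (\<lambda>y. p y + q y)"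

lemma trig_poly_const: "trig_poly (\<lambda>_. c)"
  using trig_poly.wave[of 0 c 0] by simp

lemma trig_poly_sum:
  "(\<And>i. i \<in> I \<Longrightarrow> trig_poly (p i)) \<Longrightarrow> trig_poly (\<lambda>y. \<Sum>i\<in>I. p i y)"
  by (induction I rule: infinite_finite_induct) (auto intro: trig_poly_const trig_poly.add)

text \<open>By the product-to-sum formula two integer frequencies yield their difference and their
  sum, which are integer again.\<close>

lemma trig_poly_wave_mult:
  assumes "trig_poly q" and \<xi>: "\<And>b. b \<in> Basis \<Longrightarrow> \<xi> \<bullet> b \<in> \<int>"
  shows "trig_poly (\<lambda>y. (r * cos (2 * pi * (\<xi> \<bullet> y) + \<delta>)) * q y)"
  using assms(1)
proof induction
  case (wave \<eta> s \<theta>)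
  have "trig_poly (\<lambda>y. (r * s / 2) * cos (2 * pi * ((\<xi> - \<eta>) \<bullet> y) + (\<delta> - \<theta>))
      + (r * s / 2) * cos (2 * pi * ((\<xi> + \<eta>) \<bullet> y) + (\<delta> + \<theta>)))"
    using wave \<xi> by (intro trig_poly.intros) (auto simp: inner_diff_left inner_add_left)
  thus ?case
    by (rule back_subst[of trig_poly])
       (auto simp: cos_times_cos inner_diff_left inner_add_left fun_eq_iff algebra_simps
          add_divide_distrib diff_divide_distrib)
next
  case (add p q)
  thus ?case by (simp add: distrib_left trig_poly.add)
qed

lemma trig_poly_mult: "trig_poly p \<Longrightarrow> trig_poly q \<Longrightarrow> trig_poly (\<lambda>y. p y * q y)"
  by (induction rule: trig_poly.induct) (simp_all add: trig_poly_wave_mult distrib_right trig_poly.add)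

lemma trig_poly_continuous: "trig_poly p \<Longrightarrow> continuous_on UNIV p"
  by (induction rule: trig_poly.induct) (auto intro!: continuous_intros)

lemma trig_poly_periodic: "trig_poly p \<Longrightarrow> periodic p"
proof (induction rule: trig_poly.induct)
  case (wave \<xi> r \<delta>)
  show ?case
    unfolding periodic_def
  proof safe
    fix b x :: 'a assume "b \<in> Basis"
    with wave obtain k where "\<xi> \<bullet> b = of_int k"
      using Ints_cases by blast
    hence "cos (2 * pi * (\<xi> \<bullet> (x + b)) + \<delta>) = cos (2 * pi * (\<xi> \<bullet> x) + \<delta> + 2 * pi * of_int k)"
      by (simp add: inner_add_right algebra_simps)
    also have "\<dots> = cos (2 * pi * (\<xi> \<bullet> x) + \<delta>)"
      by (simp add: cos_add)
    finally show "r * cos (2 * pi * (\<xi> \<bullet> (x + b)) + \<delta>) = r * cos (2 * pi * (\<xi> \<bullet> x) + \<delta>)"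
      by simp
  qed
qed (auto simp: periodic_def)

lemma has_dir_deriv_wave:
  "has_dir_deriv b (\<lambda>y. r * cos (2 * pi * (\<xi> \<bullet> y) + \<delta>))
     (\<lambda>y. (2 * pi * r * (\<xi> \<bullet> b)) * cos (2 * pi * (\<xi> \<bullet> y) + (\<delta> + pi / 2)))"
  unfolding has_dir_deriv_def
  by (auto intro!: derivative_eq_intros simp: inner_add_right cos_add sin_add algebra_simps)

lemma trig_poly_dir_deriv:
  assumes "trig_poly p"
  shows "has_dir_deriv b p (dir_deriv b p)" "trig_poly (dir_deriv b p)"
proof -
  have "\<exists>p'. has_dir_deriv b p p' \<and> trig_poly p'"
    using assms
  proof induction
    case (wave \<xi> r \<delta>)
    thus ?case using has_dir_deriv_wave trig_poly.wave by blast
  next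
    case (add p q)
    thus ?case using has_dir_deriv_add trig_poly.add by blast
  qed
  thus "has_dir_deriv b p (dir_deriv b p)" "trig_poly (dir_deriv b p)"
    using dir_deriv_eqI by metis+
qed

lemma dir_deriv_wave:
  "dir_deriv b (\<lambda>y. r * cos (2 * pi * (\<xi> \<bullet> y) + \<delta>)) =
     (\<lambda>y. (2 * pi * r * (\<xi> \<bullet> b)) * cos (2 * pi * (\<xi> \<bullet> y) + (\<delta> + pi / 2)))"
  by (rule dir_deriv_eqI[OF has_dir_deriv_wave])

lemma dir_deriv_add:
  "trig_poly p \<Longrightarrow> trig_poly q \<Longrightarrow> dir_deriv b (\<lambda>y. p y + q y) = (\<lambda>y. dir_deriv b p y + dir_deriv b q y)"
  by (intro dir_deriv_eqI has_dir_deriv_add trig_poly_dir_deriv)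

lemma dir_deriv_commute:
  "trig_poly p \<Longrightarrow> dir_deriv b (dir_deriv c p) = dir_deriv c (dir_deriv b p)"
proof (induction rule: trig_poly.induct)
  case (wave \<xi> r \<delta>)
  show ?case by (simp only: dir_deriv_wave) (simp add: mult_ac)
qed (simp_all add: dir_deriv_add trig_poly_dir_deriv)

definition laplacian :: "('a::euclidean_space \<Rightarrow> real) \<Rightarrow> 'a \<Rightarrow> real" where
  "laplacian p y = (\<Sum>b\<in>Basis. dir_deriv b (dir_deriv b p) y)"

lemma trig_poly_laplacian: "trig_poly p \<Longrightarrow> trig_poly (laplacian p)"
  unfolding laplacian_def [abs_def] by (intro trig_poly_sum trig_poly_dir_deriv)

lemma laplacian_add:
  "trig_poly p \<Longrightarrow> trig_poly q \<Longrightarrow> laplacian (\<lambda>y. p y + q y) = (\<lambda>y. laplacian p y + laplacian q y)"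
  by (simp add: laplacian_def[abs_def] dir_deriv_add trig_poly_dir_deriv sum.distrib)

lemma laplacian_wave:
  fixes \<xi> :: "'a::euclidean_space"
  shows "laplacian (\<lambda>y. r * cos (2 * pi * (\<xi> \<bullet> y) + \<delta>)) y
     = - (2 * pi * norm \<xi>)\<^sup>2 * (r * cos (2 * pi * (\<xi> \<bullet> y) + \<delta>))"
proof -
  have *: "cos (2 * pi * (\<xi> \<bullet> y) + (\<delta> + pi / 2 + pi / 2)) = - cos (2 * pi * (\<xi> \<bullet> y) + \<delta>)"
    by (simp add: cos_add sin_add)
  have "(norm \<xi>)\<^sup>2 = (\<Sum>b\<in>Basis. (\<xi> \<bullet> b)\<^sup>2)"
    by (subst power2_norm_eq_inner, subst euclidean_inner) (simp add: power2_eq_square)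
  moreover have "laplacian (\<lambda>y. r * cos (2 * pi * (\<xi> \<bullet> y) + \<delta>)) y
      = (\<Sum>b\<in>Basis. (- (2 * pi)\<^sup>2 * (r * cos (2 * pi * (\<xi> \<bullet> y) + \<delta>))) * (\<xi> \<bullet> b)\<^sup>2)"
    by (simp only: laplacian_def dir_deriv_wave *) (simp add: power2_eq_square mult_ac)
  ultimately show ?thesis
    by (simp only: sum_distrib_left[symmetric]) (simp add: power_mult_distrib)
qed

text \<open>The Laplacian multiplies a wave of frequency \<xi> by - (2 pi |\<xi>|)^2, which can be
  inverted unless \<xi> = 0; the waves of frequency zero make up the constant
  \<open>c\<close>.\<close>

lemma trig_poly_poisson:
  assumes "trig_poly (p :: 'a::euclidean_space \<Rightarrow> real)"
  obtains w c where "trig_poly w" "\<And>y. p y = laplacian w y + c"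
proof -
  have "\<exists>w c. trig_poly w \<and> (\<forall>y. p y = laplacian w y + c)"
    using assms
  proof induction
    case (wave \<xi> r \<delta>)
    show ?case
    proof (cases "\<xi> = 0")
      case True
      have "trig_poly (\<lambda>_::'a. 0 * cos (2 * pi * (0 \<bullet> (0::'a)) + 0))"
        by (simp add: trig_poly_const)
      moreover have "laplacian (\<lambda>y. 0 * cos (2 * pi * (0 \<bullet> y) + 0)) y = 0" for y :: 'a
        by (subst laplacian_wave) simp
      ultimately show ?thesis using True
        by (intro exI[of _ "\<lambda>_. 0"] exI[of _ "r * cos \<delta>"]) auto
    next
      case False
      let ?w = "\<lambda>y. (- r / (2 * pi * norm \<xi>)\<^sup>2) * cos (2 * pi * (\<xi> \<bullet> y) + \<delta>)"
      have "trig_poly ?w" by (intro trig_poly.wave wave)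
      moreover have "laplacian ?w y = r * cos (2 * pi * (\<xi> \<bullet> y) + \<delta>)" for y
        using False by (subst laplacian_wave) (simp add: power2_eq_square)
      ultimately show ?thesis by (intro exI[of _ ?w] exI[of _ 0]) auto
    qed
  next
    case (add p q)
    then obtain v w c d where "trig_poly v" "trig_poly w"
      "\<And>y. p y = laplacian v y + c" "\<And>y. q y = laplacian w y + d" by blast
    thus ?case
      by (intro exI[of _ "\<lambda>y. v y + w y"] exI[of _ "c + d"]) (auto simp: trig_poly.add laplacian_add)
  qed
  thus thesis using that by blast
qed

lemma trig_poly_by_parts:
  assumes "trig_poly p" "trig_poly q" "b \<in> Basis"
  shows "(\<integral>y. dir_deriv b p y * q y \<partial>torus) = - (\<integral>y. p y * dir_deriv b q y \<partial>torus)"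
  using assms
  by (intro integral_torus_by_parts[of b])
     (auto intro: trig_poly_periodic trig_poly_dir_deriv trig_poly_continuous)

text \<open>One integration by parts in j and one in k turn the square of a mixed derivative into a
  product of two pure second derivatives, and the double sum of these products is the square of the
  Laplacian.\<close>

lemma integral_torus_hessian:
  assumes "trig_poly w"
  shows "(\<Sum>j\<in>Basis. \<Sum>k\<in>Basis. \<integral>y. (dir_deriv k (dir_deriv j w) y)\<^sup>2 \<partial>torus) = (\<integral>y. (laplacian w y)\<^sup>2 \<partial>torus)"
proof -
  note tp = trig_poly_dir_deriv(2) assms
  have "(\<integral>y. (dir_deriv k (dir_deriv j w) y)\<^sup>2 \<partial>torus) =
      (\<integral>y. dir_deriv j (dir_deriv j w) y * dir_deriv k (dir_deriv k w) y \<partial>torus)"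
    if "j \<in> Basis" "k \<in> Basis" for j k
  proof -
    have "dir_deriv j (dir_deriv k (dir_deriv k w)) = dir_deriv k (dir_deriv k (dir_deriv j w))"
      by (simp add: dir_deriv_commute[of _ j] tp)
    thus ?thesis
      using that by (simp add: power2_eq_square trig_poly_by_parts tp)
  qed
  hence "(\<Sum>j\<in>Basis. \<Sum>k\<in>Basis. \<integral>y. (dir_deriv k (dir_deriv j w) y)\<^sup>2 \<partial>torus) =
     (\<Sum>j\<in>Basis. \<Sum>k\<in>Basis. \<integral>y. dir_deriv j (dir_deriv j w) y * dir_deriv k (dir_deriv k w) y \<partial>torus)"
    by simp
  also have "\<dots> = (\<integral>y. (\<Sum>j\<in>Basis. \<Sum>k\<in>Basis. dir_deriv j (dir_deriv j w) y * dir_deriv k (dir_deriv k w) y) \<partial>torus)"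
    by (subst Bochner_Integration.integral_sum Bochner_Integration.integral_sum;
        (intro sum.cong refl Bochner_Integration.integrable_sum continuous_integrable_torus continuous_intros trig_poly_continuous tp)?)+
  also have "\<dots> = (\<integral>y. (laplacian w y)\<^sup>2 \<partial>torus)"
    by (simp add: laplacian_def power2_eq_square sum_product)
  finally show ?thesis .
qed

section \<open>An elliptic estimate\<close>

text \<open>The torus as a product of unit circles: y is sent to the real and imaginary parts of exp
  (2 pi i y_b), so that exactly the points differing by a lattice vector are identified.\<close>

definition torus_embedding :: "'a::euclidean_space \<Rightarrow> 'a \<times> 'a" where
  "torus_embedding y = ((\<Sum>b\<in>Basis. cos (2 * pi * (b \<bullet> y)) *\<^sub>R b), (\<Sum>b\<in>Basis. sin (2 * pi * (b \<bullet> y)) *\<^sub>R b))"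

lemma torus_embedding_eq:
  assumes "torus_embedding x = torus_embedding y" "b \<in> Basis"
  shows "x \<bullet> b - y \<bullet> b \<in> \<int>"
proof -
  have "fst (torus_embedding x) \<bullet> b = fst (torus_embedding y) \<bullet> b"
    "snd (torus_embedding x) \<bullet> b = snd (torus_embedding y) \<bullet> b"
    using assms by simp_all
  hence "cos (2 * pi * (b \<bullet> x)) = cos (2 * pi * (b \<bullet> y))" "sin (2 * pi * (b \<bullet> x)) = sin (2 * pi * (b \<bullet> y))"
    using assms(2) by (simp_all add: torus_embedding_def)
  then obtain n :: int where "2 * pi * (b \<bullet> x) = 2 * pi * (b \<bullet> y) + 2 * pi * of_int n"
    using sin_cos_eq_iff[of "2 * pi * (b \<bullet> x)" "2 * pi * (b \<bullet> y)"] by (auto simp: mult_ac)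
  hence "2 * pi * (b \<bullet> x) = 2 * pi * (b \<bullet> y + of_int n)"
    by (simp add: algebra_simps)
  hence "b \<bullet> x = b \<bullet> y + of_int n"
    by simp
  thus ?thesis by (simp add: inner_commute)
qed

lemma periodic_lattice_shift:
  fixes f :: "'a::euclidean_space \<Rightarrow> 'b"
  assumes "periodic f" "\<And>b. b \<in> Basis \<Longrightarrow> x \<bullet> b - y \<bullet> b \<in> \<int>"
  shows "f x = f y"
proof -
  have "finite A \<Longrightarrow> A \<subseteq> Basis \<Longrightarrow> f (y + (\<Sum>b\<in>A. (x \<bullet> b - y \<bullet> b) *\<^sub>R b)) = f y" for A
  proof (induction rule: finite_induct)
    case (insert a A)
    obtain n where n: "x \<bullet> a - y \<bullet> a = of_int n"
      using assms(2)[of a] insert Ints_cases by blast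
    show ?case
      using insert periodic_int_shift[OF assms(1), of a "y + (\<Sum>b\<in>A. (x \<bullet> b - y \<bullet> b) *\<^sub>R b)" n]
      by (simp add: n add_ac)
  qed simp
  from this[of Basis] have "f (y + (\<Sum>b\<in>Basis. ((x - y) \<bullet> b) *\<^sub>R b)) = f y"
    by (simp add: inner_diff_left)
  thus ?thesis by (simp only: euclidean_representation) simp
qed

lemma trig_poly_torus_embedding:
  fixes g :: "'a::euclidean_space \<times> 'a \<Rightarrow> real"
  assumes "real_polynomial_function g"
  shows "trig_poly (\<lambda>y. g (torus_embedding y))"
  using assms
proof induction
  case (linear f)
  interpret f: bounded_linear f by fact
  \<comment> \<open>The coefficients are \<open>f (b, 0)\<close> on the cosines and
    \<open>f (0, b)\<close> on the sines, a sine being a cosine with phase - pi / 2.\<close>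
  have "trig_poly (\<lambda>y. (\<Sum>b\<in>Basis. f (b, 0) * cos (2 * pi * (b \<bullet> y) + 0)) +
      (\<Sum>b\<in>Basis. f (0, b) * cos (2 * pi * (b \<bullet> y) + (- pi / 2))))"
    by (intro trig_poly.intros trig_poly_sum) (auto simp: inner_Basis)
  moreover have "f (torus_embedding y) = (\<Sum>b\<in>Basis. f (b, 0) * cos (2 * pi * (b \<bullet> y) + 0)) +
      (\<Sum>b\<in>Basis. f (0, b) * cos (2 * pi * (b \<bullet> y) + (- pi / 2)))" for y
  proof -
    have "torus_embedding y = (\<Sum>b\<in>Basis. cos (2 * pi * (b \<bullet> y)) *\<^sub>R (b, 0)) + (\<Sum>b\<in>Basis. sin (2 * pi * (b \<bullet> y)) *\<^sub>R (0, b))"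
      by (simp add: torus_embedding_def prod_eq_iff fst_sum snd_sum)
    thus ?thesis
      by (simp only: f.add f.sum f.scaleR) (simp add: cos_diff mult.commute)
  qed
  ultimately show ?case by simp
qed (auto intro: trig_poly_const trig_poly.add trig_poly_mult)

text \<open>
  A periodic function factors through the compact image of \<^const>\<open>torus_embedding\<close>, and
  polynomials in the coordinates of that image are trigonometric polynomials.
\<close>

lemma trig_poly_dense:
  fixes f :: "'a::euclidean_space \<Rightarrow> real"
  assumes f: "continuous_on UNIV f" and per: "periodic f" and \<epsilon>: "\<epsilon> > 0"
  obtains p where "trig_poly p" "\<And>y. y \<in> unit_cell \<Longrightarrow> \<bar>f y - p y\<bar> < \<epsilon>"
proof -
  let ?K = "cbox 0 One :: 'a set" and ?E = "torus_embedding :: 'a \<Rightarrow> 'a \<times> 'a"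
  have cE: "continuous_on ?K ?E"
    unfolding torus_embedding_def [abs_def] by (intro continuous_intros)
  \<comment> \<open>A continuous map from a compact space to a Hausdorff space is a quotient map
    onto its image. As \<open>f\<close> is constant on the fibres, it descends to a continuous
    \<open>g\<close>.\<close>
  have "quotient_map (top_of_set ?K) (top_of_set (?E ` ?K)) ?E"
    using cE by (intro continuous_imp_quotient_map)
      (auto simp: compact_space_subtopology Hausdorff_space_subtopology continuous_map_in_subtopology)
  moreover have "continuous_map (top_of_set ?K) euclidean f"
    using continuous_on_subset[OF f] by simp
  ultimately obtain g where g: "continuous_map (top_of_set (?E ` ?K)) euclidean g"
    "\<And>x. x \<in> ?K \<Longrightarrow> g (?E x) = f x"
    by (rule quotient_map_lift_exists)
       (use per in \<open>auto intro: periodic_lattice_shift torus_embedding_eq\<close>)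
  have "compact (?E ` ?K)" by (intro compact_continuous_image cE) auto
  moreover have "continuous_on (?E ` ?K) g" using g(1) by simp
  ultimately obtain h where h: "real_polynomial_function h" "\<And>x. x \<in> ?E ` ?K \<Longrightarrow> \<bar>g x - h x\<bar> < \<epsilon>"
    using Stone_Weierstrass_real_polynomial_function \<epsilon> by metis
  show thesis
  proof
    show "trig_poly (\<lambda>y. h (?E y))" by (intro trig_poly_torus_embedding h)
    fix y :: 'a assume "y \<in> unit_cell"
    hence "y \<in> ?K" using unit_cell_bounds(2) by blast
    thus "\<bar>f y - h (?E y)\<bar> < \<epsilon>" using g(2) h(2) by (metis imageI)
  qed
qed

text \<open>
  The duality form of the boundedness of the Riesz transforms: \<open>f\<close> is approximated by a Laplacian
  \<open>\<Delta>w\<close>, the right-hand side is tested with the Hessian of \<open>w\<close>, and \<open>\<parallel>D\<^sup>2 w\<parallel> = \<parallel>\<Delta>w\<parallel>\<close> in \<open>L\<^sup>2\<close>.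
\<close>

lemma elliptic_estimate:
  fixes f :: "'a::euclidean_space \<Rightarrow> real" and R :: "'a \<Rightarrow> 'a \<Rightarrow> 'a \<Rightarrow> real"
  assumes f: "continuous_on UNIV f" "periodic f" "(\<integral>y. f y \<partial>torus) = 0"
      "\<And>j. j \<in> Basis \<Longrightarrow> has_dir_deriv j f (\<lambda>y. \<Sum>k\<in>Basis. R' j k y)"
    and R: "\<And>j k. continuous_on UNIV (R j k)" "\<And>j k. periodic (R j k)"
      "\<And>j k. continuous_on UNIV (R' j k)" "\<And>j k. k \<in> Basis \<Longrightarrow> has_dir_deriv k (R j k) (R' j k)"
  shows "(\<integral>y. (f y)\<^sup>2 \<partial>torus) \<le> (\<Sum>j\<in>Basis. \<Sum>k\<in>Basis. \<integral>y. (R j k y)\<^sup>2 \<partial>torus)"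
    (is "?X \<le> ?R")
proof -
  note cont = continuous_intros f(1) R(1,3) trig_poly_dir_deriv(2)
    trig_poly_continuous[OF trig_poly_laplacian] trig_poly_continuous[OF trig_poly_dir_deriv(2)]
    continuous_integrable_torus
  \<comment> \<open>Young's inequality with weights 1/2 and 1/2 is what leaves the final constant
    equal to one.\<close>
  have dual: "(\<integral>y. f y * laplacian w y \<partial>torus) \<le> ?R / 2 + (\<integral>y. (laplacian w y)\<^sup>2 \<partial>torus) / 2"
    if w: "trig_poly w" for w
  proof -
    note tp = trig_poly_dir_deriv w
    have "(\<integral>y. f y * laplacian w y \<partial>torus) = (\<Sum>j\<in>Basis. \<integral>y. f y * dir_deriv j (dir_deriv j w) y \<partial>torus)"
      unfolding laplacian_def sum_distrib_left
      by (intro Bochner_Integration.integral_sum cont w)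
    also have "\<dots> = (\<Sum>j\<in>Basis. - (\<integral>y. (\<Sum>k\<in>Basis. R' j k y) * dir_deriv j w y \<partial>torus))"
    proof (intro sum.cong refl)
      fix j :: 'a assume j: "j \<in> Basis"
      have "(\<integral>y. (\<Sum>k\<in>Basis. R' j k y) * dir_deriv j w y \<partial>torus) = - (\<integral>y. f y * dir_deriv j (dir_deriv j w) y \<partial>torus)"
        by (intro integral_torus_by_parts[of j] j f cont trig_poly_periodic tp w)
      thus "(\<integral>y. f y * dir_deriv j (dir_deriv j w) y \<partial>torus) = - (\<integral>y. (\<Sum>k\<in>Basis. R' j k y) * dir_deriv j w y \<partial>torus)"
        by simp
    qed
    also have "\<dots> = (\<Sum>j\<in>Basis. \<Sum>k\<in>Basis. - (\<integral>y. R' j k y * dir_deriv j w y \<partial>torus))"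
      unfolding sum_distrib_right sum_negf[symmetric]
      by (subst Bochner_Integration.integral_sum) (auto intro!: cont w simp: sum_negf)
    also have "\<dots> = (\<Sum>j\<in>Basis. \<Sum>k\<in>Basis. \<integral>y. R j k y * dir_deriv k (dir_deriv j w) y \<partial>torus)"
    proof (intro sum.cong refl)
      fix j k :: 'a assume k: "k \<in> Basis"
      show "- (\<integral>y. R' j k y * dir_deriv j w y \<partial>torus) = (\<integral>y. R j k y * dir_deriv k (dir_deriv j w) y \<partial>torus)"
        by (subst integral_torus_by_parts[of k "R j k" "dir_deriv j w" _ "dir_deriv k (dir_deriv j w)"])
           (auto intro!: k R cont trig_poly_periodic tp w)
    qed
    also have "\<dots> \<le> (\<Sum>j\<in>Basis. \<Sum>k\<in>Basis. \<integral>y. (R j k y)\<^sup>2 / 2 + (dir_deriv k (dir_deriv j w) y)\<^sup>2 / 2 \<partial>torus)"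
    proof (intro sum_mono Bochner_Integration.integral_mono cont w)
      fix j k y
      show "R j k y * dir_deriv k (dir_deriv j w) y \<le> (R j k y)\<^sup>2 / 2 + (dir_deriv k (dir_deriv j w) y)\<^sup>2 / 2"
        using sum_squares_bound[of "R j k y" "dir_deriv k (dir_deriv j w) y"] by simp
    qed auto
    also have "\<dots> = (\<Sum>j\<in>Basis. \<Sum>k\<in>Basis. (\<integral>y. (R j k y)\<^sup>2 \<partial>torus) / 2 + (\<integral>y. (dir_deriv k (dir_deriv j w) y)\<^sup>2 \<partial>torus) / 2)"
      by (subst Bochner_Integration.integral_add) (auto intro!: cont w)
    also have "\<dots> = ?R / 2 + (\<Sum>j\<in>Basis. \<Sum>k\<in>Basis. \<integral>y. (dir_deriv k (dir_deriv j w) y)\<^sup>2 \<partial>torus) / 2"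
      by (simp add: sum.distrib sum_divide_distrib)
    finally show ?thesis by (simp add: integral_torus_hessian w)
  qed
  have "?X \<le> ?R + \<epsilon>" if "\<epsilon> > 0" for \<epsilon>
  proof -
    \<comment> \<open>The error f - laplacian w is the sum of f - p and the constant
      \<open>c\<close>, each at most \<delta> in absolute value, so its square is at most (2
      \<delta>)^2 = \<epsilon>.\<close>
    define \<delta> where "\<delta> = sqrt \<epsilon> / 2"
    have \<delta>: "\<delta> > 0" "(2 * \<delta>)\<^sup>2 = \<epsilon>" using that by (auto simp: \<delta>_def)
    obtain p where p: "trig_poly p" "\<And>y. y \<in> unit_cell \<Longrightarrow> \<bar>f y - p y\<bar> < \<delta>"
      using trig_poly_dense[OF f(1,2) \<delta>(1)] by blast
    obtain w c where w: "trig_poly w" and c: "\<And>y. p y = laplacian w y + c"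
      using trig_poly_poisson[OF p(1)] by blast
    \<comment> \<open>Since \<open>f\<close> and \<open>laplacian w\<close> both have mean zero,
      \<open>c\<close> is the mean of p - f and hence as small as the approximation error.\<close>
    have "(\<integral>y. laplacian w y \<partial>torus) = 0"
    proof -
      have "(\<integral>y. laplacian w y \<partial>torus) = (\<Sum>j\<in>Basis. \<integral>y. dir_deriv j (dir_deriv j w) y \<partial>torus)"
        unfolding laplacian_def by (intro Bochner_Integration.integral_sum cont w)
      also have "\<dots> = 0"
      proof (intro sum.neutral ballI)
        fix j :: 'a assume j: "j \<in> Basis"
        show "(\<integral>y. dir_deriv j (dir_deriv j w) y \<partial>torus) = 0"
          by (rule integral_torus_dir_deriv[OF j, of "dir_deriv j w"])
             (intro cont w trig_poly_periodic trig_poly_dir_deriv)+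
      qed
      finally show ?thesis .
    qed
    moreover have "(\<integral>y. f y - (laplacian w y + c) \<partial>torus) = (\<integral>y. f y \<partial>torus) - ((\<integral>y. laplacian w y \<partial>torus) + c)"
      by (subst Bochner_Integration.integral_diff Bochner_Integration.integral_add; (intro cont w)?; simp?)+
    ultimately have "- c = (\<integral>y. f y - p y \<partial>torus)"
      using f(3) by (simp add: c)
    moreover have "\<bar>\<integral>y. f y - p y \<partial>torus\<bar> \<le> (\<integral>y. \<bar>f y - p y\<bar> \<partial>torus)"
      using integral_norm_bound[of torus "\<lambda>y. f y - p y"] by simp
    moreover have "(\<integral>y. \<bar>f y - p y\<bar> \<partial>torus) \<le> (\<integral>y. \<delta> \<partial>(torus :: 'a measure))"
      by (intro Bochner_Integration.integral_mono cont trig_poly_continuous[OF p(1)]) (auto intro: less_imp_le p)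
    moreover have "(\<integral>y. \<delta> \<partial>(torus :: 'a measure)) = \<delta>" by simp
    ultimately have "\<bar>c\<bar> \<le> \<delta>" by linarith
    hence near: "(f y - laplacian w y)\<^sup>2 \<le> \<epsilon>" if "y \<in> unit_cell" for y
      using p(2)[OF that] c[of y] unfolding \<delta>(2)[symmetric] by (intro abs_le_square_iff[THEN iffD1]) auto
    \<comment> \<open>Completing the square, f^2 = 2 f (laplacian w) - (laplacian w)^2 + (f -
      laplacian w)^2. Doubling \<open>dual\<close> then cancels the integral of (laplacian w)^2
      exactly.\<close>
    have "(\<integral>y. (f y)\<^sup>2 \<partial>torus) \<le> (\<integral>y. 2 * (f y * laplacian w y) - (laplacian w y)\<^sup>2 + \<epsilon> \<partial>torus)"
    proof (intro Bochner_Integration.integral_mono cont w)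
      fix y :: 'a assume "y \<in> space torus"
      thus "(f y)\<^sup>2 \<le> 2 * (f y * laplacian w y) - (laplacian w y)\<^sup>2 + \<epsilon>"
        using near[of y] by (simp add: power2_diff)
    qed
    also have "\<dots> = 2 * (\<integral>y. f y * laplacian w y \<partial>torus) - (\<integral>y. (laplacian w y)\<^sup>2 \<partial>torus) + \<epsilon>"
      by (subst Bochner_Integration.integral_diff Bochner_Integration.integral_add; (intro cont w)?; simp?)+
    also have "\<dots> \<le> ?R + \<epsilon>"
      using dual[OF w] by simp
    finally show ?thesis .
  qed
  thus ?thesis by (rule field_le_epsilon)
qed

section \<open>The symbol of the Euler operator and plane waves\<close>

text \<open>Up to the factor 2 pi i this is the Fourier symbol of \<open>euler_op\<close>. It is
  bilinear in the wave vector and the state, and its values at basis vectors are the coefficient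
  matrices of the operator.\<close>

definition euler_symbol :: "real \<times> (real ^ 'd) \<Rightarrow> 'd::finite state \<Rightarrow> (real ^ 'd) \<times> real" where
  "euler_symbol = (\<lambda>(\<tau>, k) (\<rho>, m, M, Q). (\<tau> *\<^sub>R m + M *v k + Q *\<^sub>R k, \<tau> * \<rho> + k \<bullet> m))"

lemma linear_euler_symbol_right: "linear (euler_symbol \<xi>)"
  by (cases \<xi>, rule linearI)
     (auto simp: euler_symbol_def algebra_simps matrix_vector_mult_add_rdistrib scaleR_matrix_vector_assoc)

lemma linear_euler_symbol_left: "linear (\<lambda>\<xi>. euler_symbol \<xi> W)"
  by (cases W, rule linearI)
     (auto simp: euler_symbol_def algebra_simps matrix_vector_right_distrib matrix_vector_mult_scaleR)

lemma frechet_derivative_linear_compose: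
  assumes "f differentiable (at y)" "bounded_linear L"
  shows "frechet_derivative (\<lambda>y. L (f y)) (at y) = (\<lambda>v. L (frechet_derivative f (at y) v))"
  using bounded_linear.has_derivative[OF assms(2) frechet_derivative_works[THEN iffD1, OF assms(1)]]
  by (rule frechet_derivative_at[symmetric])

lemma sum_Basis_spacetime:
  fixes g :: "real \<times> (real ^ 'd) \<Rightarrow> 'b::comm_monoid_add"
  shows "(\<Sum>b\<in>Basis. g b) = g (1, 0) + (\<Sum>j\<in>UNIV. g (0, axis j 1))"
proof -
  have B: "(Basis :: (real ^ 'd) set) = range (\<lambda>j. axis j 1)"
    by (auto simp: Basis_vec_def)
  have inj: "inj (\<lambda>j::'d. (0::real, axis j (1::real)))"
    by (auto simp: inj_def axis_eq_axis)
  have "(\<Sum>b\<in>Basis. g b) = (\<Sum>b\<in>insert (1, 0) (range (\<lambda>j. (0, axis j 1))). g b)"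
    unfolding Basis_prod_def B by (intro sum.cong) auto
  also have "\<dots> = g (1, 0) + (\<Sum>b\<in>range (\<lambda>j. (0, axis j 1)). g b)"
    by (subst sum.insert) auto
  also have "(\<Sum>b\<in>range (\<lambda>j. (0, axis j 1)). g b) = (\<Sum>j\<in>UNIV. g (0, axis j 1))"
    by (subst sum.reindex[OF inj]) simp
  finally show ?thesis .
qed

text \<open>The componentwise definition of the operator is resolved here; afterwards linearity of
  the symbol in each argument suffices.\<close>

lemma euler_op_eq:
  fixes \<phi> :: "real \<times> (real ^ 'd) \<Rightarrow> 'd::finite state"
  assumes "\<phi> differentiable (at y)"
  shows "euler_op \<phi> y = (\<Sum>b\<in>Basis. euler_symbol b (frechet_derivative \<phi> (at y) b))"
proof -
  let ?D = "frechet_derivative \<phi> (at y)"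
  note bl = bounded_linear_fst bounded_linear_snd bounded_linear_compose[OF bounded_linear_fst bounded_linear_snd]
    bounded_linear_compose[OF bounded_linear_fst bounded_linear_compose[OF bounded_linear_snd bounded_linear_snd]]
    bounded_linear_compose[OF bounded_linear_snd bounded_linear_compose[OF bounded_linear_snd bounded_linear_snd]]
  note fd = bl[THEN frechet_derivative_linear_compose[OF assms]]
  have axis_nth: "axis j (1::real) $ i = (if i = j then 1 else 0)" for i j :: 'd
    by (simp add: axis_def)
  show ?thesis
    unfolding sum_Basis_spacetime euler_op_def Let_def euler_symbol_def case_prod_unfold D_t_def D_x_def fd
    by (simp add: prod_eq_iff vec_eq_iff fst_sum snd_sum matrix_vector_mult_basis column_def axis_nth
        sum.distrib inner_axis' sum_component if_distrib cong: if_cong)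
qed

lemma subspace_states: "subspace (states :: 'd::finite state set)"
  by (auto simp: states_def subspace_def transpose_def trace_def vec_eq_iff sum.distrib sum_distrib_left[symmetric] zero_prod_def)

lemma closed_states: "closed (states :: 'd::finite state set)"
  by (rule closed_subspace[OF subspace_states])

section \<open>Plane waves in the kernel of the operator\<close>

lemma has_derivative_wave:
  fixes \<xi> :: "'a::euclidean_space" and V :: "'b::real_normed_vector"
  assumes "f holomorphic_on S" "open S" "\<And>s::real. of_real s \<in> S"
  shows "((\<lambda>y. Re (f (of_real (\<xi> \<bullet> y))) *\<^sub>R V) has_derivative
    (\<lambda>h. Re (deriv f (of_real (\<xi> \<bullet> y))) *\<^sub>R ((\<xi> \<bullet> h) *\<^sub>R V))) (at y)"
proof -
  have "(f has_field_derivative deriv f (of_real (\<xi> \<bullet> y))) (at (of_real (\<xi> \<bullet> y)))"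
    by (rule holomorphic_derivI[OF assms])
  hence "(f has_derivative (*) (deriv f (of_real (\<xi> \<bullet> y)))) (at (of_real (\<xi> \<bullet> y)))"
    by (simp add: has_field_derivative_def)
  hence "((\<lambda>y. f (of_real (\<xi> \<bullet> y))) has_derivative (\<lambda>h. deriv f (of_real (\<xi> \<bullet> y)) * of_real (\<xi> \<bullet> h))) (at y)"
    by (rule has_derivative_compose[rotated]) (auto intro!: derivative_eq_intros)
  hence "((\<lambda>y. Re (f (of_real (\<xi> \<bullet> y)))) has_derivative (\<lambda>h. Re (deriv f (of_real (\<xi> \<bullet> y))) * (\<xi> \<bullet> h))) (at y)"
    by (auto dest: has_derivative_Re)
  from bounded_linear.has_derivative[OF bounded_linear_scaleR_left this, of V]
  show ?thesis by simp
qed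

text \<open>
  Holomorphy near the real line provides the derivatives of all orders at once.
\<close>

lemma smooth_wave:
  fixes \<xi> :: "'a::euclidean_space" and V :: "'b::real_normed_vector"
  assumes "f holomorphic_on S" "open S" "\<And>s::real. of_real s \<in> S"
  shows "smooth (\<lambda>y. Re (f (of_real (\<xi> \<bullet> y))) *\<^sub>R V)"
proof -
  have "C_k k (\<lambda>y. Re (f (of_real (\<xi> \<bullet> y))) *\<^sub>R V)" for k
    using assms(1)
  proof (induction k arbitrary: f V)
    case 0
    have "continuous_on UNIV (\<lambda>y. f (of_real (\<xi> \<bullet> y)))"
      by (intro continuous_on_compose2[OF holomorphic_on_imp_continuous_on[OF 0]])
         (auto intro!: continuous_intros assms)
    thus ?case by (auto intro!: continuous_intros)
  next
    case (Suc k)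
    \<comment> \<open>The derivative is again a wave, with \<open>deriv f\<close> for
      \<open>f\<close> and a multiple of \<open>V\<close> for \<open>V\<close>; hence the induction
      generalises over both.\<close>
    note D = has_derivative_wave[OF Suc.prems assms(2,3)]
    have "frechet_derivative (\<lambda>y. Re (f (of_real (\<xi> \<bullet> y))) *\<^sub>R V) (at y) b =
        Re (deriv f (of_real (\<xi> \<bullet> y))) *\<^sub>R ((\<xi> \<bullet> b) *\<^sub>R V)" for y b
      by (subst frechet_derivative_at[OF D, symmetric]) simp
    moreover have "(\<lambda>y. Re (f (of_real (\<xi> \<bullet> y))) *\<^sub>R V) differentiable_on UNIV"
      using D by (auto simp: differentiable_on_def differentiable_def)
    ultimately show ?case
      using Suc.IH[OF holomorphic_deriv[OF Suc.prems assms(2)]] by (simp del: scaleR_scaleR)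
  qed
  thus ?thesis by (simp add: smooth_def)
qed

lemma smooth_imp_differentiable: "smooth f \<Longrightarrow> f differentiable_on UNIV"
  unfolding smooth_def by (metis C_k.simps(2))


text \<open>All partial derivatives of the wave are multiples of \<open>V\<close> by the coordinates
  of \<xi>, so linearity reassembles the sum over basis vectors into the symbol at \<xi>
  itself.\<close>

lemma euler_op_wave:
  assumes "f holomorphic_on S" "open S" "\<And>s::real. of_real s \<in> S" and "euler_symbol \<xi> V = 0"
  shows "euler_op (\<lambda>y. Re (f (of_real (\<xi> \<bullet> y))) *\<^sub>R V) y = 0"
proof -
  let ?\<phi> = "\<lambda>y. Re (f (of_real (\<xi> \<bullet> y))) *\<^sub>R V"
  have diff: "?\<phi> differentiable (at y)"
    using smooth_imp_differentiable[OF smooth_wave[OF assms(1-3), of \<xi> V]] by (simp add: differentiable_on_def del: split_paired_All)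
  note D = has_derivative_wave[OF assms(1-3)]
  have "euler_op ?\<phi> y = (\<Sum>b\<in>Basis. euler_symbol b (Re (deriv f (of_real (\<xi> \<bullet> y))) *\<^sub>R ((\<xi> \<bullet> b) *\<^sub>R V)))"
    by (simp only: euler_op_eq[OF diff] frechet_derivative_at[OF D, symmetric])
  also have "\<dots> = Re (deriv f (of_real (\<xi> \<bullet> y))) *\<^sub>R euler_symbol (\<Sum>b\<in>Basis. (\<xi> \<bullet> b) *\<^sub>R b) V"
    by (simp add: linear_sum[OF linear_euler_symbol_left] linear_cmul[OF linear_euler_symbol_left]
        linear_cmul[OF linear_euler_symbol_right] scaleR_sum_right)
  also have "\<dots> = 0"
    by (simp only: euclidean_representation assms(4) scaleR_zero_right)
  finally show ?thesis .
qed

text \<open>The wave h (\<xi> \<bullet> y) V is a competitor: integer coordinates of \<xi> give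
  periodicity, \<xi> \<noteq> 0 reduces torus integrals to one period of \<open>h\<close>, and
  \<open>H\<close> provides smoothness.\<close>

lemma euler_envelope_le_wave:
  fixes f :: "'d::finite state \<Rightarrow> real"
  assumes H: "H holomorphic_on S" "open S" "\<And>s::real. of_real s \<in> S"
    and h: "\<And>s. h s = Re (H (of_real s))" "periodic h" "integral {0..1} h = 0"
    and \<xi>: "\<And>b. b \<in> Basis \<Longrightarrow> \<xi> \<bullet> b \<in> \<int>" "\<xi> \<noteq> 0" "euler_symbol \<xi> V = 0"
    and V: "V \<in> states" and z: "z \<in> states" and f: "continuous_on states f"
  shows "euler_envelope f z \<le> ereal (integral {0..1} (\<lambda>s. f (z + h s *\<^sub>R V)))"
proof -
  let ?\<phi> = "\<lambda>y. h (\<xi> \<bullet> y) *\<^sub>R V"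
  have ch: "continuous_on UNIV h"
    unfolding h(1)
    by (intro continuous_on_compose2[OF holomorphic_on_imp_continuous_on[OF H(1)]] continuous_intros)
       (auto intro: H)
  have per: "periodic ?\<phi>"
    unfolding periodic_def
  proof safe
    fix b x :: "real \<times> (real ^ 'd)" assume "b \<in> Basis"
    then obtain n where "\<xi> \<bullet> b = of_int n" using \<xi>(1) Ints_cases by blast
    thus "h (\<xi> \<bullet> (x + b)) *\<^sub>R V = h (\<xi> \<bullet> x) *\<^sub>R V"
      using periodic_int_shift[OF h(2), of 1 "\<xi> \<bullet> x" n] by (simp add: inner_add_right)
  qed
  have int0: "(\<integral>y. ?\<phi> y \<partial>torus) = 0"
    by (subst Bochner_Integration.integral_scaleR_left)
       (auto simp: integral_torus_plane_wave[OF ch h(2) \<xi>(1,2)] h(3)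
         intro!: continuous_integrable_torus continuous_on_compose2[OF ch] continuous_intros)
  have in_states: "z + c *\<^sub>R V \<in> states" for c
    using V z by (intro subspace_add subspace_scale subspace_states)
  have "(\<integral>y. f (z + ?\<phi> y) \<partial>torus) = integral {0..1} (\<lambda>s. f (z + h s *\<^sub>R V))"
  proof (rule integral_torus_plane_wave[OF _ _ \<xi>(1,2), where F = "\<lambda>s. f (z + h s *\<^sub>R V)"])
    show "continuous_on UNIV (\<lambda>s. f (z + h s *\<^sub>R V))"
      by (intro continuous_on_compose2[OF f] continuous_intros ch) (use in_states in auto)
    show "periodic (\<lambda>s. f (z + h s *\<^sub>R V))"
      using h(2) by (auto simp: periodic_def)
  qed
  moreover have "euler_envelope f z \<le> ereal (\<integral>y. f (z + ?\<phi> y) \<partial>torus)"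
    unfolding euler_envelope_def
  proof (rule Inf_lower, rule CollectI, intro exI[of _ ?\<phi>] conjI refl)
    show "smooth ?\<phi>" unfolding h(1) by (rule smooth_wave[OF H])
    show "range ?\<phi> \<subseteq> states" using subspace_scale[OF subspace_states V] by blast
    show "\<forall>y. euler_op ?\<phi> y = 0" unfolding h(1) using euler_op_wave[OF H \<xi>(3)] by blast
  qed (fact per int0)+
  ultimately show ?thesis by simp
qed

section \<open>Oscillation between two states\<close>

context
  fixes l :: real
  assumes l: "0 < l" "l < 1"
begin

text \<open>The logistic function of n (cos (2 pi z) - cos (pi l)). On the real line it tends to the
  indicator of the points closer than l / 2 to an integer, a set that fills the fraction l of each
  period. The complex version serves to establish holomorphy.\<close>

definition sigmoid_wave :: "nat \<Rightarrow> complex \<Rightarrow> complex" where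
  "sigmoid_wave n z = 1 / (1 + exp (- of_nat n * (cos (of_real (2 * pi) * z) - of_real (cos (pi * l)))))"

definition sigmoid_real :: "nat \<Rightarrow> real \<Rightarrow> real" where
  "sigmoid_real n s = 1 / (1 + exp (- real n * (cos (2 * pi * s) - cos (pi * l))))"

text \<open>The exact mean is subtracted and not its limit l, because competitors must have mean
  zero for every n.\<close>

definition profile :: "nat \<Rightarrow> real \<Rightarrow> real" where
  "profile n s = sigmoid_real n s - integral {0..1} (sigmoid_real n)"

lemma sigmoid_wave_of_real: "sigmoid_wave n (of_real s) = of_real (sigmoid_real n s)"
  by (simp add: sigmoid_wave_def sigmoid_real_def flip: exp_of_real cos_of_real)

lemma sigmoid_real_bounds: "0 \<le> sigmoid_real n s" "sigmoid_real n s \<le> 1"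
  by (auto simp: sigmoid_real_def add_nonneg_nonneg divide_simps add_pos_pos)

lemma continuous_sigmoid_real: "continuous_on UNIV (sigmoid_real n)"
  unfolding sigmoid_real_def [abs_def]
  by (intro continuous_intros) (metis add_pos_pos exp_gt_zero less_irrefl zero_less_one)

lemma integral_sigmoid_real: "integral {0..1} (sigmoid_real n) \<in> {0..1}"
proof -
  have "(\<integral>s. 0 \<partial>(torus :: real measure)) \<le> (\<integral>s. sigmoid_real n s \<partial>torus)"
    by (intro Bochner_Integration.integral_mono continuous_integrable_torus continuous_sigmoid_real)
       (auto simp: sigmoid_real_bounds)
  moreover have "(\<integral>s. sigmoid_real n s \<partial>torus) \<le> (\<integral>s. 1 \<partial>(torus :: real measure))"
    by (intro Bochner_Integration.integral_mono continuous_integrable_torus continuous_sigmoid_real)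
       (auto simp: sigmoid_real_bounds)
  ultimately show ?thesis
    by (simp add: integral_torus_real continuous_sigmoid_real)
qed

lemma profile_bound: "\<bar>profile n s\<bar> \<le> 1"
  using sigmoid_real_bounds[of n s] integral_sigmoid_real[of n] by (auto simp: profile_def)

text \<open>On the real line the denominator of the logistic function exceeds 1, so its zeros stay
  away and their complement is an open set containing all reals.\<close>

lemma profile_holomorphic:
  "\<exists>H S. H holomorphic_on S \<and> open S \<and> (\<forall>s::real. of_real s \<in> S) \<and> (\<forall>s. profile n s = Re (H (of_real s)))"
proof -
  let ?d = "\<lambda>z::complex. 1 + exp (- of_nat n * (cos (of_real (2 * pi) * z) - of_real (cos (pi * l))))"
  let ?S = "?d -` (- {0})"
  have "open ?S"
    by (rule open_vimage) (auto intro!: continuous_intros)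
  moreover have "of_real s \<in> ?S" for s :: real
  proof -
    have "?d (of_real s) = of_real (1 + exp (- real n * (cos (2 * pi * s) - cos (pi * l))))"
      by (simp add: flip: exp_of_real cos_of_real)
    moreover have "1 + exp (- real n * (cos (2 * pi * s) - cos (pi * l))) \<noteq> 0"
      by (metis add_pos_pos exp_gt_zero less_irrefl zero_less_one)
    ultimately have "?d (of_real s) \<noteq> 0" by (simp only: of_real_eq_0_iff not_False_eq_True)
    thus ?thesis by simp
  qed
  moreover have "(\<lambda>z. sigmoid_wave n z - of_real (integral {0..1} (sigmoid_real n))) holomorphic_on ?S"
    unfolding sigmoid_wave_def by (intro holomorphic_intros) auto
  moreover have "profile n s = Re (sigmoid_wave n (of_real s) - of_real (integral {0..1} (sigmoid_real n)))" for s
    by (simp add: profile_def sigmoid_wave_of_real)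
  ultimately show ?thesis by blast
qed

lemma profile_periodic: "periodic (profile n)"
  by (auto simp: periodic_def profile_def sigmoid_real_def distrib_left cos_add)

lemma continuous_profile: "continuous_on UNIV (profile n)"
  unfolding profile_def [abs_def] by (intro continuous_intros continuous_sigmoid_real)

lemma integral_profile: "integral {0..1} (profile n) = 0"
  unfolding profile_def [abs_def]
  by (subst integral_diff) (auto intro!: integrable_continuous_real continuous_on_subset[OF continuous_sigmoid_real])

text \<open>The cosine is decreasing on [0, pi], which settles s \<le> 1 / 2; the reflection s
  \<mapsto> 1 - s settles the rest.\<close>

lemma cos_threshold:
  assumes "s \<in> unit_cell"
  shows "cos (2 * pi * s) > cos (pi * l) \<longleftrightarrow> s < l / 2 \<or> s > 1 - l / 2"
    and "cos (2 * pi * s) = cos (pi * l) \<longleftrightarrow> s = l / 2 \<or> s = 1 - l / 2"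
proof -
  have *: "(cos (2 * pi * r) > cos (pi * l) \<longleftrightarrow> r < l / 2) \<and> (cos (2 * pi * r) = cos (pi * l) \<longleftrightarrow> r = l / 2)"
    if "0 \<le> r" "r \<le> 1 / 2" for r
  proof -
    have "2 * pi * r \<le> pi" "pi * l \<le> pi" using that l by (simp_all add: mult_le_cancel_left2)
    moreover have "0 \<le> 2 * pi * r" "0 \<le> pi * l" using that l by simp_all
    ultimately have "(cos (pi * l) < cos (2 * pi * r)) = (2 * pi * r < pi * l)"
      "cos (2 * pi * r) = cos (pi * l) \<longleftrightarrow> 2 * pi * r = pi * l"
      using cos_mono_less_eq[of "pi * l" "2 * pi * r"] cos_inj_pi[of "2 * pi * r" "pi * l"] by metis+
    moreover have "2 * pi * r < pi * l \<longleftrightarrow> r < l / 2" "2 * pi * r = pi * l \<longleftrightarrow> r = l / 2"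
      using mult_less_cancel_left_pos[of pi "2 * r" l] by auto
    ultimately show ?thesis by simp
  qed
  have sym: "cos (2 * pi * (1 - s)) = cos (2 * pi * s)"
    by (simp add: right_diff_distrib cos_diff)
  have s: "0 \<le> s" "s < 1" using assms by (auto simp: unit_cell_real)
  have "(cos (2 * pi * s) > cos (pi * l) \<longleftrightarrow> s < l / 2 \<or> s > 1 - l / 2) \<and>
      (cos (2 * pi * s) = cos (pi * l) \<longleftrightarrow> s = l / 2 \<or> s = 1 - l / 2)"
  proof (cases "s \<le> 1 / 2")
    case True
    with l have "\<not> s > 1 - l / 2" "s \<noteq> 1 - l / 2" by linarith+
    with *[of s] True s show ?thesis by simp
  next
    case False
    with l have "\<not> s < l / 2" "s \<noteq> l / 2" "1 - s < l / 2 \<longleftrightarrow> s > 1 - l / 2" "1 - s = l / 2 \<longleftrightarrow> s = 1 - l / 2"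
      by linarith+
    with *[of "1 - s"] False s show ?thesis unfolding sym by simp
  qed
  thus "cos (2 * pi * s) > cos (pi * l) \<longleftrightarrow> s < l / 2 \<or> s > 1 - l / 2"
    "cos (2 * pi * s) = cos (pi * l) \<longleftrightarrow> s = l / 2 \<or> s = 1 - l / 2" by blast+
qed

lemma threshold_measurable:
  "(\<lambda>s. if cos (2 * pi * s) > cos (pi * l) then a else b :: real) \<in> borel_measurable borel"
proof (rule measurable_If)
  have "open {s. cos (pi * l) < cos (2 * pi * s)}"
    by (intro open_Collect_less continuous_intros)
  thus "{s \<in> space borel. cos (pi * l) < cos (2 * pi * s)} \<in> sets borel" by simp
qed auto

lemma integral_threshold:
  "(\<integral>s. (if cos (2 * pi * s) > cos (pi * l) then a else b) \<partial>torus) = l * a + (1 - l) * (b::real)"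
proof -
  let ?A = "{0..<l / 2} \<union> {1 - l / 2<..<1}"
  have A: "?A \<subseteq> unit_cell" using l by (auto simp: unit_cell_real)
  have "measure torus ?A = measure lborel ?A"
    using A by (subst measure_restrict_space) (auto simp: measure_completion)
  also have "\<dots> = l"
    using l by (subst measure_Union) (auto simp: fmeasurable_def emeasure_lborel_Ico emeasure_lborel_Ioo)
  finally have A_measure: "measure torus ?A = l" .
  have A_sets: "?A \<in> sets torus"
    using A by (auto simp: sets_restrict_space_iff)
  have "integrable torus (indicator ?A :: real \<Rightarrow> real)"
    using A_sets by (intro integrable_real_indicator) (auto simp: torus.emeasure_eq_measure)
  note A_int = integrable_mult_right[OF this, of "a - b"]
  have "(\<integral>s. (if cos (2 * pi * s) > cos (pi * l) then a else b) \<partial>torus) = (\<integral>s. (a - b) * indicator ?A s + b \<partial>torus)"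
    using l by (intro Bochner_Integration.integral_cong) (auto simp: cos_threshold indicator_def unit_cell_real)
  also have "\<dots> = (a - b) * l + b"
    using A_sets A_measure A by (subst Bochner_Integration.integral_add[OF A_int]) (auto simp: Int_absorb2)
  finally show ?thesis by (simp add: algebra_simps)
qed

lemma AE_threshold: "AE s in torus. cos (2 * pi * s) \<noteq> cos (pi * l)"
proof -
  have "AE s in lborel. s \<noteq> l / 2 \<and> s \<noteq> 1 - l / 2"
    by (intro AE_conjI AE_lborel_singleton)
  hence "AE s in lebesgue. s \<noteq> l / 2 \<and> s \<noteq> 1 - l / 2"
    by (rule AE_completion)
  thus ?thesis
    by (subst AE_restrict_space_iff) (auto simp: cos_threshold)
qed

text \<open>At the threshold itself every \<open>sigmoid_real n\<close> equals 1 / 2, hence the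
  exclusion of that null set.\<close>

lemma sigmoid_real_tendsto:
  assumes "cos (2 * pi * s) \<noteq> cos (pi * l)"
  shows "(\<lambda>n. sigmoid_real n s) \<longlonglongrightarrow> (if cos (2 * pi * s) > cos (pi * l) then 1 else 0)"
proof (cases "cos (2 * pi * s) > cos (pi * l)")
  case True
  define d where "d = cos (2 * pi * s) - cos (pi * l)"
  have "d > 0" using True by (simp add: d_def)
  hence "(\<lambda>n. 1 / (1 + exp (- real n * d))) \<longlonglongrightarrow> 1" by real_asymp
  thus ?thesis using True by (simp add: sigmoid_real_def d_def)
next
  case False
  define d where "d = cos (2 * pi * s) - cos (pi * l)"
  have "d < 0" using False assms by (simp add: d_def)
  hence "(\<lambda>n. 1 / (1 + exp (- real n * d))) \<longlonglongrightarrow> 0" by real_asymp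
  thus ?thesis using False by (simp add: sigmoid_real_def d_def)
qed

lemma profile_tendsto:
  assumes "cos (2 * pi * s) \<noteq> cos (pi * l)"
  shows "(\<lambda>n. profile n s) \<longlonglongrightarrow> (if cos (2 * pi * s) > cos (pi * l) then 1 - l else - l)"
proof -
  have "(\<lambda>n. integral\<^sup>L torus (sigmoid_real n))
      \<longlonglongrightarrow> (\<integral>s. (if cos (2 * pi * s) > cos (pi * l) then 1 else 0) \<partial>torus)"
  proof (rule integral_dominated_convergence[where w = "\<lambda>_. 1"])
    show "AE s in torus. (\<lambda>n. sigmoid_real n s) \<longlonglongrightarrow> (if cos (2 * pi * s) > cos (pi * l) then 1 else 0)"
      using AE_threshold by eventually_elim (rule sigmoid_real_tendsto)
  qed (auto intro!: borel_measurable_torus threshold_measurable borel_measurable_continuous_onI continuous_sigmoid_real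
         simp: sigmoid_real_bounds)
  hence "(\<lambda>n. integral {0..1} (sigmoid_real n)) \<longlonglongrightarrow> l"
    by (simp add: integral_threshold integral_torus_real continuous_sigmoid_real)
  from tendsto_diff[OF sigmoid_real_tendsto[OF assms] this] show ?thesis
    unfolding profile_def by (auto split: if_splits)
qed

text \<open>The profile tends to 1 - l on the fraction l of a period and to - l on the rest, so the
  oscillation around the barycentre tends to \<open>z\<^sub>1\<close> and \<open>z\<^sub>2\<close>
  with the right weights. Dominated convergence passes to the limit in the profile and in
  \<open>V n\<close> at the same time.\<close>

lemma euler_envelope_two_point:
  fixes f :: "'d::finite state \<Rightarrow> real"
  assumes f: "continuous_on states f" and z: "z\<^sub>1 \<in> states" "z\<^sub>2 \<in> states"
    and V: "\<And>n. V n \<in> states" "V \<longlonglongrightarrow> z\<^sub>1 - z\<^sub>2"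
    and \<xi>: "\<And>n b. b \<in> Basis \<Longrightarrow> \<xi> n \<bullet> b \<in> \<int>" "\<And>n. \<xi> n \<noteq> 0" "\<And>n. euler_symbol (\<xi> n) (V n) = 0"
  shows "euler_envelope f (l *\<^sub>R z\<^sub>1 + (1 - l) *\<^sub>R z\<^sub>2) \<le> ereal (l * f z\<^sub>1 + (1 - l) * f z\<^sub>2)"
proof -
  define z where "z = l *\<^sub>R z\<^sub>1 + (1 - l) *\<^sub>R z\<^sub>2"
  have z_states: "z \<in> states"
    unfolding z_def using z by (intro subspace_add subspace_scale subspace_states)
  have in_states: "z + c *\<^sub>R V n \<in> states" for c n
    using V(1) z_states by (intro subspace_add subspace_scale subspace_states)
  define F where "F = (\<lambda>n s. f (z + profile n s *\<^sub>R V n))"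
  have cF: "continuous_on UNIV (F n)" for n
    unfolding F_def by (intro continuous_on_compose2[OF f] continuous_intros continuous_profile)
      (use in_states in auto)
  obtain r where r: "\<And>n. norm (V n) \<le> r"
    using convergent_imp_Bseq[OF convergentI[OF V(2)]] by (auto simp: Bseq_def)
  \<comment> \<open>A bound for \<open>f\<close> is available only on compact subsets of
    \<open>states\<close>. The radius \<open>r\<close> suffices because the profile is at most 1 in
    absolute value.\<close>
  have "compact (cball z r \<inter> states)"
    by (intro compact_Int_closed closed_states) simp
  then obtain B where B: "\<And>w. w \<in> cball z r \<inter> states \<Longrightarrow> norm (f w) \<le> B"
    using compact_imp_bounded[OF compact_continuous_image[OF continuous_on_subset[OF f]]]
    by (metis (no_types, lifting) Int_lower2 bounded_iff imageI)
  have FB: "norm (F n s) \<le> B" for n s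
  proof -
    have "\<bar>profile n s\<bar> * norm (V n) \<le> 1 * r"
      by (intro mult_mono profile_bound r) auto
    thus ?thesis unfolding F_def
      by (intro B) (auto simp: in_states dist_norm)
  qed
  have "(\<lambda>n. integral\<^sup>L torus (F n)) \<longlonglongrightarrow>
      (\<integral>s. (if cos (2 * pi * s) > cos (pi * l) then f z\<^sub>1 else f z\<^sub>2) \<partial>torus)"
  proof (rule integral_dominated_convergence[where w = "\<lambda>_. B"])
    show "AE s in torus. (\<lambda>n. F n s) \<longlonglongrightarrow> (if cos (2 * pi * s) > cos (pi * l) then f z\<^sub>1 else f z\<^sub>2)"
      using AE_threshold
    proof eventually_elim
      case (elim s)
      let ?c = "if cos (2 * pi * s) > cos (pi * l) then 1 - l else - l"
      let ?w = "if cos (2 * pi * s) > cos (pi * l) then z\<^sub>1 else z\<^sub>2"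
      have "(\<lambda>n. z + profile n s *\<^sub>R V n) \<longlonglongrightarrow> z + ?c *\<^sub>R (z\<^sub>1 - z\<^sub>2)"
        by (intro tendsto_intros profile_tendsto elim V)
      also have "z + ?c *\<^sub>R (z\<^sub>1 - z\<^sub>2) = ?w"
        by (simp add: z_def algebra_simps)
      finally have "(\<lambda>n. F n s) \<longlonglongrightarrow> f ?w"
        unfolding F_def using z in_states by (intro continuous_on_tendsto_compose[OF f]) auto
      thus ?case by (simp add: if_distrib)
    qed
  qed (auto intro!: borel_measurable_torus threshold_measurable borel_measurable_continuous_onI cF FB[unfolded real_norm_def])
  hence lim: "(\<lambda>n. ereal (integral {0..1} (F n))) \<longlonglongrightarrow> ereal (l * f z\<^sub>1 + (1 - l) * f z\<^sub>2)"
    by (simp add: integral_threshold integral_torus_real cF)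
  have "euler_envelope f z \<le> ereal (integral {0..1} (F n))" for n
  proof -
    obtain H S where H: "H holomorphic_on S" "open S" "\<And>s::real. of_real s \<in> S"
      "\<And>s. profile n s = Re (H (of_real s))" using profile_holomorphic[of n] by blast
    show ?thesis unfolding F_def
      by (rule euler_envelope_le_wave[OF H profile_periodic integral_profile \<xi> V(1) z_states f])
  qed
  thus ?thesis
    unfolding z_def by (intro LIMSEQ_le_const[OF lim]) blast
qed

end

section \<open>The wave cone\<close>

lemma lift_in_states: "lift w \<in> (states :: 'd::finite state set)"
proof (cases w)
  case (Pair u p)
  have "trace (tensor u u) = (norm u)\<^sup>2"
    unfolding power2_norm_eq_inner by (simp add: trace_def tensor_def inner_vec_def)
  moreover have "trace (c *\<^sub>R (mat 1 :: real ^ 'd ^ 'd)) = c * real CARD('d)" for c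
    by (simp add: trace_def mat_def)
  ultimately show ?thesis using Pair
    by (simp add: lift_def states_def trace_sub)
       (simp add: transpose_def tensor_def mat_def vec_eq_iff mult.commute)
qed

lemma continuous_lift: "continuous_on UNIV (lift :: _ \<Rightarrow> 'd::finite state)"
proof -
  have "continuous_on UNIV (\<lambda>w::(real ^ 'd) \<times> real. tensor (fst w) (fst w))"
    unfolding tensor_def by (intro continuous_intros)
  thus ?thesis
    unfolding lift_def case_prod_unfold by (intro continuous_intros) auto
qed

text \<open>The terms |u|^2 / d in the matrix and in the pressure slot cancel when applied to k, so
  only u \<otimes> u and the pressure remain; then (u \<bullet> k) u - (v \<bullet> k) v = (u
  \<bullet> k) (u - v) + ((u - v) \<bullet> k) v.\<close>

lemma euler_symbol_lift_diff:
  fixes u v :: "real ^ 'd::finite"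
  shows "euler_symbol (\<tau>, k) (lift (u, p) - lift (v, q)) =
    ((\<tau> + u \<bullet> k) *\<^sub>R (u - v) + ((u - v) \<bullet> k) *\<^sub>R v + (p - q) *\<^sub>R k, k \<bullet> (u - v))"
proof -
  have tensor: "tensor w w *v k = (w \<bullet> k) *\<^sub>R w" for w :: "real ^ 'd"
    by (simp add: tensor_def matrix_vector_mult_def inner_vec_def vec_eq_iff sum_distrib_left mult_ac)
  show ?thesis
    by (simp add: euler_symbol_def lift_def matrix_vector_mult_diff_rdistrib tensor
        scaleR_matrix_vector_assoc[symmetric] inner_diff_left algebra_simps)
qed

text \<open>k is u - v turned by a right angle, and the time frequency cancels u \<bullet> k. All
  entries are polynomials in the velocities with integer coefficients, so rational velocities give
  rational wave vectors.\<close>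

definition wave_vector :: "real ^ 2 \<Rightarrow> real ^ 2 \<Rightarrow> real \<times> (real ^ 2)" where
  "wave_vector u v = (let k = vector [v $ 2 - u $ 2, u $ 1 - v $ 1] in (- (u \<bullet> k), k))"

lemma euler_symbol_wave_vector: "euler_symbol (wave_vector u v) (lift (u, p) - lift (v, p)) = 0"
  unfolding wave_vector_def Let_def euler_symbol_lift_diff
  by (simp add: inner_vec_def sum_2 algebra_simps zero_prod_def)

section \<open>Rational velocities and integer wave vectors\<close>

lemma rational_sequence:
  fixes x :: real
  obtains r where "\<And>n. r n \<in> \<rat>" "\<And>n. r n \<noteq> c n" "r \<longlonglongrightarrow> x"
proof -
  have "\<exists>r\<in>\<rat>. r \<noteq> c n \<and> x < r \<and> r < x + 1 / real (Suc n)" for n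
  proof (cases "x < c n")
    case True
    then obtain r where "r \<in> \<rat>" "x < r" "r < min (c n) (x + 1 / real (Suc n))"
      using Rats_dense_in_real[of x "min (c n) (x + 1 / real (Suc n))"] by auto
    thus ?thesis by (intro bexI[of _ r]) auto
  next
    case False
    obtain r where "r \<in> \<rat>" "x < r" "r < x + 1 / real (Suc n)"
      using Rats_dense_in_real[of x "x + 1 / real (Suc n)"] by auto
    thus ?thesis using False by (intro bexI[of _ r]) auto
  qed
  then obtain r where r: "\<And>n. r n \<in> \<rat>" "\<And>n. r n \<noteq> c n" "\<And>n. x < r n" "\<And>n. r n < x + 1 / real (Suc n)"
    by metis
  have "r \<longlonglongrightarrow> x"
  proof (rule tendsto_sandwich[of "\<lambda>_. x"])
    show "(\<lambda>n. x + 1 / real (Suc n)) \<longlonglongrightarrow> x" by real_asymp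
  qed (use r in \<open>auto intro!: always_eventually less_imp_le\<close>)
  thus thesis using that r by blast
qed

lemma Rats_common_denominator:
  assumes "finite A" "A \<subseteq> \<rat>"
  obtains D :: nat where "D > 0" "\<And>x. x \<in> A \<Longrightarrow> real D * x \<in> \<int>"
proof -
  have "\<exists>D::nat. D > 0 \<and> (\<forall>x\<in>A. real D * x \<in> \<int>)"
    using assms
  proof (induction rule: finite_induct)
    case (insert a A)
    then obtain D :: nat where D: "D > 0" "\<forall>x\<in>A. real D * x \<in> \<int>" by auto
    from insert.prems have "a \<in> \<rat>" by simp
    then obtain m n :: nat where "n \<noteq> 0" "\<bar>a\<bar> = real m / real n"
      by (rule Rats_abs_nat_div_natE)
    hence "real n * \<bar>a\<bar> \<in> \<int>" by simp
    hence n: "real n * a \<in> \<int>" by (auto simp: abs_if split: if_splits)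
    have "\<forall>x\<in>insert a A. real (n * D) * x \<in> \<int>"
    proof
      fix x assume "x \<in> insert a A"
      thus "real (n * D) * x \<in> \<int>"
      proof
        assume "x = a"
        thus ?thesis using Ints_mult[OF Ints_of_nat[of D] n] by (simp add: mult_ac)
      next
        assume "x \<in> A"
        hence "real D * x \<in> \<int>" using D by blast
        from Ints_mult[OF Ints_of_nat[of n] this] show ?thesis by (simp add: mult_ac)
      qed
    qed
    thus ?case using D \<open>n \<noteq> 0\<close> by (intro exI[of _ "n * D"]) auto
  qed (auto intro: exI[of _ 1])
  thus thesis using that by blast
qed

lemma Basis_spacetime_2: "(Basis :: (real \<times> (real ^ 2)) set) = {(1, 0), (0, axis 1 1), (0, axis 2 1)}"
  by (auto simp: Basis_prod_def Basis_vec_def UNIV_2)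

text \<open>The symbol is homogeneous in the wave vector, so clearing denominators keeps its kernel.
  Different first coordinates of the velocities make the vector nonzero.\<close>

lemma integer_wave_vector:
  fixes u v :: "real ^ 2"
  assumes "\<And>i. u $ i \<in> \<rat>" "\<And>i. v $ i \<in> \<rat>" "u $ 1 \<noteq> v $ 1"
  obtains \<xi> where "\<And>b. b \<in> Basis \<Longrightarrow> \<xi> \<bullet> b \<in> \<int>" "\<xi> \<noteq> 0"
    "\<And>p. euler_symbol \<xi> (lift (u, p) - lift (v, p)) = 0"
proof -
  obtain D :: nat where D: "D > 0"
    "\<And>x. x \<in> {fst (wave_vector u v), snd (wave_vector u v) $ 1, snd (wave_vector u v) $ 2} \<Longrightarrow> real D * x \<in> \<int>"
  proof (rule Rats_common_denominator)
    show "{fst (wave_vector u v), snd (wave_vector u v) $ 1, snd (wave_vector u v) $ 2} \<subseteq> \<rat>"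
      using assms by (auto simp: wave_vector_def Let_def inner_vec_def sum_2)
  qed auto
  show thesis
  proof
    fix b :: "real \<times> (real ^ 2)" assume "b \<in> Basis"
    thus "(real D *\<^sub>R wave_vector u v) \<bullet> b \<in> \<int>"
      using D(2) by (auto simp: Basis_spacetime_2 inner_prod_def inner_axis)
  next
    have "wave_vector u v \<noteq> 0"
      using assms(3) by (auto simp: wave_vector_def Let_def zero_prod_def vec_eq_iff forall_2)
    thus "real D *\<^sub>R wave_vector u v \<noteq> 0" using D(1) by simp
    show "euler_symbol (real D *\<^sub>R wave_vector u v) (lift (u, p) - lift (v, p)) = 0" for p
      by (simp add: linear_cmul[OF linear_euler_symbol_left] euler_symbol_wave_vector)
  qed
qed

text \<open>The first coordinates are kept apart along the sequences even when those of
  \<open>u\<close> and \<open>v\<close> agree; this is the purpose of the values \<open>c n\<close>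
  avoided in \<open>rational_sequence\<close>.\<close>

lemma rational_vector_sequences:
  fixes u v :: "real ^ 2"
  obtains U V :: "nat \<Rightarrow> real ^ 2" where "U \<longlonglongrightarrow> u" "V \<longlonglongrightarrow> v"
    "\<And>n i. U n $ i \<in> \<rat>" "\<And>n i. V n $ i \<in> \<rat>" "\<And>n. U n $ 1 \<noteq> V n $ 1"
proof -
  obtain a where a: "\<And>n. a n \<in> \<rat>" "a \<longlonglongrightarrow> u $ 1"
    using rational_sequence[of "\<lambda>_. 0" "u $ 1"] by metis
  obtain b where b: "\<And>n. b n \<in> \<rat>" "b \<longlonglongrightarrow> u $ 2"
    using rational_sequence[of "\<lambda>_. 0" "u $ 2"] by metis
  obtain c where c: "\<And>n. c n \<in> \<rat>" "\<And>n. c n \<noteq> a n" "c \<longlonglongrightarrow> v $ 1"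
    using rational_sequence[of a "v $ 1"] by metis
  obtain d where d: "\<And>n. d n \<in> \<rat>" "d \<longlonglongrightarrow> v $ 2"
    using rational_sequence[of "\<lambda>_. 0" "v $ 2"] by metis
  show thesis
  proof
    have lim: "(\<lambda>n. vector [r n, s n]) \<longlonglongrightarrow> w" if "r \<longlonglongrightarrow> w $ 1" "s \<longlonglongrightarrow> w $ 2" for r s and w :: "real ^ 2"
    proof (rule vec_tendstoI)
      fix i :: 2
      show "(\<lambda>n. vector [r n, s n] $ i) \<longlonglongrightarrow> w $ i"
        using exhaust_2[of i] that by (elim disjE) simp_all
    qed
    show "(\<lambda>n. vector [a n, b n]) \<longlonglongrightarrow> u" "(\<lambda>n. vector [c n, d n]) \<longlonglongrightarrow> v"
      by (rule lim; fact)+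
    show "vector [a n, b n] $ i \<in> \<rat>" "vector [c n, d n] $ i \<in> \<rat>" for n and i :: 2
      using exhaust_2[of i] a(1) b(1) c(1) d(1) by (auto elim!: disjE)
    show "vector [a n, b n] $ 1 \<noteq> (vector [c n, d n] :: real ^ 2) $ 1" for n
      using c(2)[of n] by simp
  qed
qed

lemma euler_envelope_le_lift:
  fixes u v :: "real ^ 2"
  assumes l: "0 < l" "l < 1" and f: "continuous_on states f" and uv: "u = v \<or> p = q"
  shows "euler_envelope f (l *\<^sub>R lift (u, p) + (1 - l) *\<^sub>R lift (v, q)) \<le> ereal (l * f (lift (u, p)) + (1 - l) * f (lift (v, q)))"
proof (cases "u = v")
  case True
  \<comment> \<open>For equal velocities the states differ in the pressure slot alone, and an
    oscillation purely in time is admissible; its direction is already an integer vector.\<close>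
  have sym: "euler_symbol (1, 0) (lift (u, p) - lift (v, q)) = 0"
    using True by (simp add: euler_symbol_lift_diff zero_prod_def)
  show ?thesis
    by (rule euler_envelope_two_point[OF l f lift_in_states lift_in_states, where V = "\<lambda>_. lift (u, p) - lift (v, q)" and \<xi> = "\<lambda>_. (1, 0)"])
       (auto simp: sym inner_Basis Basis_spacetime_2 zero_prod_def intro: subspace_diff subspace_states lift_in_states)
next
  case False
  with uv have [simp]: "q = p" by simp
  obtain U V where UV: "U \<longlonglongrightarrow> u" "V \<longlonglongrightarrow> v"
    "\<And>n i. U n $ i \<in> \<rat>" "\<And>n i. V n $ i \<in> \<rat>" "\<And>n. U n $ 1 \<noteq> V n $ 1"
    using rational_vector_sequences[of u v] by blast
  \<comment> \<open>The pressure stays fixed along the approximation, so each difference of lifts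
    lies exactly on the wave cone.\<close>
  have "\<exists>\<xi>. (\<forall>b\<in>Basis. \<xi> \<bullet> b \<in> \<int>) \<and> \<xi> \<noteq> 0 \<and> euler_symbol \<xi> (lift (U n, p) - lift (V n, p)) = 0" for n
    using integer_wave_vector[of "U n" "V n"] UV by metis
  then obtain \<xi> where \<xi>: "\<And>n b. b \<in> Basis \<Longrightarrow> \<xi> n \<bullet> b \<in> \<int>" "\<And>n. \<xi> n \<noteq> 0"
    "\<And>n. euler_symbol (\<xi> n) (lift (U n, p) - lift (V n, p)) = 0" by metis
  have lim: "(\<lambda>n. lift (W n, p)) \<longlonglongrightarrow> lift (w, p)" if "W \<longlonglongrightarrow> w" for W and w :: "real ^ 2"
    using that by (intro continuous_on_tendsto_compose[OF continuous_lift]) (auto intro!: tendsto_intros)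
  show ?thesis unfolding \<open>q = p\<close>
    by (rule euler_envelope_two_point[OF l f lift_in_states lift_in_states _ _ \<xi>])
       (auto intro!: tendsto_diff lim UV subspace_diff subspace_states lift_in_states)
qed

section \<open>Quasiconvex quadratic forms off the wave cone\<close>

lemma smooth_imp_continuous_derivative:
  fixes f :: "'a::euclidean_space \<Rightarrow> 'b::real_normed_vector"
  assumes "smooth f"
  shows "continuous_on UNIV (\<lambda>y. frechet_derivative f (at y) v)"
proof -
  have "C_k (Suc 0) f" using assms by (simp only: smooth_def)
  hence C: "f differentiable_on UNIV" "\<And>b. b \<in> Basis \<Longrightarrow> continuous_on UNIV (\<lambda>y. frechet_derivative f (at y) b)"
    by simp_all
  have "frechet_derivative f (at y) v = (\<Sum>b\<in>Basis. (v \<bullet> b) *\<^sub>R frechet_derivative f (at y) b)" for y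
  proof -
    have lin: "linear (frechet_derivative f (at y))"
      using C(1) by (simp add: differentiable_on_def linear_frechet_derivative)
    have "frechet_derivative f (at y) v = frechet_derivative f (at y) (\<Sum>b\<in>Basis. (v \<bullet> b) *\<^sub>R b)"
      by (simp only: euclidean_representation)
    thus ?thesis by (simp only: linear_sum[OF lin] linear_cmul[OF lin])
  qed
  thus ?thesis by (simp only:) (intro continuous_intros C(2))
qed

text \<open>Here \<open>c k\<close> stands for the derivative of chi along k and \<open>r k\<close>
  for that of the remainder. The terms with \<open>U\<close> add up to the symbol at the vector with
  coordinates \<open>c k\<close>; injectivity in the wave vector provides a left inverse
  \<open>G\<close>, which recovers this vector from the \<open>r k\<close>.\<close>

lemma euler_symbol_elliptic:
  assumes U: "\<And>\<xi>. euler_symbol \<xi> U = 0 \<Longrightarrow> \<xi> = 0"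
  obtains L :: "real \<times> (real ^ 'd) \<Rightarrow> real \<times> (real ^ 'd) \<Rightarrow> 'd::finite state \<Rightarrow> real"
  where "\<And>j k. linear (L j k)"
    "\<And>c r j. (\<Sum>k\<in>Basis. euler_symbol k (c k *\<^sub>R U + r k)) = 0 \<Longrightarrow> j \<in> Basis \<Longrightarrow> c j = (\<Sum>k\<in>Basis. L j k (r k))"
proof -
  let ?K = "\<lambda>\<xi>. euler_symbol \<xi> U"
  have "inj ?K"
    using U linear_injective_0[OF linear_euler_symbol_left] by blast
  then obtain G where G: "linear G" "G \<circ> ?K = id"
    using linear_injective_left_inverse[OF linear_euler_symbol_left] by blast
  show thesis
  proof
    show "linear (\<lambda>W. - (j \<bullet> G (euler_symbol k W)))" for j k
      using linear_compose[OF linear_euler_symbol_right G(1), of k]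
      by (intro linearI)
         (auto simp: linear_add[OF G(1)] linear_cmul[OF G(1)] linear_add[OF linear_euler_symbol_right]
           linear_cmul[OF linear_euler_symbol_right] inner_add_right)
    fix c :: "real \<times> (real ^ 'd) \<Rightarrow> real" and r and j :: "real \<times> (real ^ 'd)"
    assume eq: "(\<Sum>k\<in>Basis. euler_symbol k (c k *\<^sub>R U + r k)) = 0" and j: "j \<in> Basis"
    have "(\<Sum>k\<in>Basis. euler_symbol k (c k *\<^sub>R U + r k)) = ?K (\<Sum>k\<in>Basis. c k *\<^sub>R k) + (\<Sum>k\<in>Basis. euler_symbol k (r k))"
      by (simp add: linear_add[OF linear_euler_symbol_right] linear_cmul[OF linear_euler_symbol_right]
          linear_sum[OF linear_euler_symbol_left] linear_cmul[OF linear_euler_symbol_left] sum.distrib)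
    with eq have "?K (\<Sum>k\<in>Basis. c k *\<^sub>R k) = - (\<Sum>k\<in>Basis. euler_symbol k (r k))"
      by (simp add: eq_neg_iff_add_eq_0)
    hence "G (?K (\<Sum>k\<in>Basis. c k *\<^sub>R k)) = - (\<Sum>k\<in>Basis. G (euler_symbol k (r k)))"
      by (simp add: linear_neg[OF G(1)] linear_sum[OF G(1)])
    hence "(\<Sum>k\<in>Basis. c k *\<^sub>R k) = - (\<Sum>k\<in>Basis. G (euler_symbol k (r k)))"
      using G(2)[THEN fun_cong, of "\<Sum>k\<in>Basis. c k *\<^sub>R k"] by simp
    hence "j \<bullet> (\<Sum>k\<in>Basis. c k *\<^sub>R k) = (\<Sum>k\<in>Basis. - (j \<bullet> G (euler_symbol k (r k))))"
      by (simp add: inner_sum_right sum_negf)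
    moreover have "j \<bullet> (\<Sum>k\<in>Basis. c k *\<^sub>R k) = c j"
      using j by (simp add: inner_sum_right inner_Basis if_distrib cong: if_cong)
    ultimately show "c j = (\<Sum>k\<in>Basis. - (j \<bullet> G (euler_symbol k (r k))))" by simp
  qed
qed

text \<open>Mean zero kills the cross term, so the average of a quadratic form splits into its value
  at \<open>z\<close> and the average over the oscillation.\<close>

lemma integral_torus_linear_square:
  fixes a :: "'b::euclidean_space \<Rightarrow> real" and \<phi> :: "'a::euclidean_space \<Rightarrow> 'b"
  assumes a: "linear a" and \<phi>: "continuous_on UNIV \<phi>" "(\<integral>y. \<phi> y \<partial>torus) = 0"
  shows "(\<integral>y. a (\<phi> y) \<partial>torus) = 0"
    "(\<integral>y. (a (z + \<phi> y))\<^sup>2 \<partial>torus) = (a z)\<^sup>2 + (\<integral>y. (a (\<phi> y))\<^sup>2 \<partial>torus)"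
    "continuous_on UNIV (\<lambda>y. a (\<phi> y))"
proof -
  have bl: "bounded_linear a" using a by (simp add: linear_conv_bounded_linear)
  show 0: "(\<integral>y. a (\<phi> y) \<partial>torus) = 0"
    using integral_bounded_linear[OF bl continuous_integrable_torus[OF \<phi>(1)]] \<phi>(2)
    by (simp add: linear_0[OF a])
  show c: "continuous_on UNIV (\<lambda>y. a (\<phi> y))"
    by (rule bounded_linear.continuous_on[OF bl \<phi>(1)])
  have "(\<integral>y. (a (z + \<phi> y))\<^sup>2 \<partial>torus) = (\<integral>y. ((a z)\<^sup>2 + 2 * a z * a (\<phi> y)) + (a (\<phi> y))\<^sup>2 \<partial>torus)"
    by (simp add: linear_add[OF a] power2_sum algebra_simps)
  also have "\<dots> = (\<integral>y. (a z)\<^sup>2 + 2 * a z * a (\<phi> y) \<partial>torus) + (\<integral>y. (a (\<phi> y))\<^sup>2 \<partial>torus)"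
    by (intro Bochner_Integration.integral_add continuous_integrable_torus continuous_intros c)
  also have "(\<integral>y. (a z)\<^sup>2 + 2 * a z * a (\<phi> y) \<partial>torus) = (a z)\<^sup>2"
    by (subst Bochner_Integration.integral_add) (auto intro!: continuous_integrable_torus continuous_intros c simp: 0)
  finally show "(\<integral>y. (a (z + \<phi> y))\<^sup>2 \<partial>torus) = (a z)\<^sup>2 + (\<integral>y. (a (\<phi> y))\<^sup>2 \<partial>torus)" .
qed

text \<open>
  Off the wave cone the state is separated from it by a quadratic form \<open>f\<close> with \<open>f U = -1\<close>: the
  elliptic estimate makes \<open>f\<close> quasiconvex along the kernel of the operator.
\<close>

lemma quasiconvex_quadratic:
  fixes U :: "'d::finite state"
  assumes U: "\<And>\<xi>. euler_symbol \<xi> U = 0 \<Longrightarrow> \<xi> = 0"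
  obtains f :: "'d state \<Rightarrow> real" where "continuous_on UNIV f"
    "\<And>z. ereal (f z) \<le> euler_envelope f z"
    "\<And>l x. f x + l * (1 - l) * f U = l * f (x + (1 - l) *\<^sub>R U) + (1 - l) * f (x - l *\<^sub>R U)" "f U < 0"
proof -
  obtain L :: "real \<times> (real ^ 'd) \<Rightarrow> real \<times> (real ^ 'd) \<Rightarrow> 'd state \<Rightarrow> real"
  where L: "\<And>j k. linear (L j k)"
    "\<And>c r j. (\<Sum>k\<in>Basis. euler_symbol k (c k *\<^sub>R U + r k)) = 0 \<Longrightarrow> j \<in> Basis \<Longrightarrow> c j = (\<Sum>k\<in>Basis. L j k (r k))"
    using euler_symbol_elliptic[OF U] by blast
  have "U \<noteq> 0"
  proof
    assume "U = 0"
    hence "euler_symbol (1, 0) U = 0" by (simp add: linear_0[OF linear_euler_symbol_right])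
    from U[OF this] show False by (simp add: zero_prod_def)
  qed
  \<comment> \<open>The coordinate chi along \<open>U\<close>, normalised to be 1 at
    \<open>U\<close>.\<close>
  define h where "h = (\<lambda>W. (W \<bullet> U) / (U \<bullet> U))"
  have "U \<bullet> U \<noteq> 0" using \<open>U \<noteq> 0\<close> by (simp only: inner_eq_zero_iff not_False_eq_True)
  hence "h U = 1" unfolding h_def by (rule divide_self)
  moreover have "linear h"
    unfolding h_def by (intro linearI; simp add: inner_add_left add_divide_distrib)
  ultimately have h: "linear h" "h U = 1" by simp_all
  \<comment> \<open>The functionals from the inverted symbol, applied to the component orthogonal to
    \<open>U\<close>; they therefore vanish at \<open>U\<close>.\<close>
  define R where "R = (\<lambda>j k W. L j k (W - h W *\<^sub>R U))"
  have "linear (\<lambda>W. W - h W *\<^sub>R U)"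
    by (rule linearI) (simp_all add: linear_add[OF h(1)] linear_cmul[OF h(1)] algebra_simps)
  from linear_compose[OF this L(1)] have R: "linear (R j k)" for j k
    by (simp add: R_def o_def)
  have R_U: "R j k U = 0" for j k
    by (simp add: R_def h linear_0[OF L(1)])
  \<comment> \<open>The squares are chosen so that their average over an admissible field is
    precisely the right-hand side of \<open>elliptic_estimate\<close> for chi.\<close>
  define f where "f = (\<lambda>W. (\<Sum>j\<in>Basis. \<Sum>k\<in>Basis. (R j k W)\<^sup>2) - (h W)\<^sup>2)"
  have cont: "continuous_on UNIV a" if "linear a" for a :: "'d state \<Rightarrow> real"
    using that by (simp add: linear_continuous_on linear_conv_bounded_linear)
  show thesis
  proof
    show "continuous_on UNIV f"
      unfolding f_def by (intro continuous_intros cont R h)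
    show "f U < 0" by (simp add: f_def R_U h)
    \<comment> \<open>On the line x + c U the form is a constant minus (h x + c)^2, so the gap is
      the variance l (1 - l) of the values 1 - l and - l with weights l and 1 - l.\<close>
    show "f x + l * (1 - l) * f U = l * f (x + (1 - l) *\<^sub>R U) + (1 - l) * f (x - l *\<^sub>R U)" for l x
    proof -
      have "f (x + c *\<^sub>R U) = (\<Sum>j\<in>Basis. \<Sum>k\<in>Basis. (R j k x)\<^sup>2) - (h x + c)\<^sup>2" for c
        by (simp add: f_def linear_add[OF R] linear_cmul[OF R] R_U linear_add[OF h(1)] linear_cmul[OF h(1)] h(2))
      from this[of "1 - l"] this[of "- l"] this[of 0] show ?thesis
        by (simp add: f_def[THEN fun_cong, of U] R_U h(2)) (simp add: power2_eq_square algebra_simps)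
    qed
    show "ereal (f z) \<le> euler_envelope f z" for z
      unfolding euler_envelope_def
    proof (rule Inf_greatest, safe)
      fix \<phi> :: "real \<times> (real ^ 'd) \<Rightarrow> 'd state"
      assume \<phi>: "smooth \<phi>" "periodic \<phi>" "range \<phi> \<subseteq> states" "\<forall>y. euler_op \<phi> y = 0" "(\<integral>y. \<phi> y \<partial>torus) = 0"
      have diff: "\<phi> differentiable_on UNIV" by (rule smooth_imp_differentiable[OF \<phi>(1)])
      have c\<phi>: "continuous_on UNIV \<phi>" by (rule differentiable_imp_continuous_on[OF diff])
      note sq = integral_torus_linear_square[OF _ c\<phi> \<phi>(5)]
      have dd: "has_dir_deriv b (\<lambda>y. a (\<phi> y)) (\<lambda>y. a (frechet_derivative \<phi> (at y) b))" if "linear a" for a :: "'d state \<Rightarrow> real" and b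
        using that by (intro has_derivative_has_dir_deriv diff) (simp add: linear_conv_bounded_linear)
      have est: "(\<integral>y. (h (\<phi> y))\<^sup>2 \<partial>torus) \<le> (\<Sum>j\<in>Basis. \<Sum>k\<in>Basis. \<integral>y. (R j k (\<phi> y))\<^sup>2 \<partial>torus)"
      proof (rule elliptic_estimate)
        fix j :: "real \<times> (real ^ 'd)" assume j: "j \<in> Basis"
        have "h (frechet_derivative \<phi> (at y) j) = (\<Sum>k\<in>Basis. R j k (frechet_derivative \<phi> (at y) k))" for y
        proof -
          let ?D = "frechet_derivative \<phi> (at y)"
          \<comment> \<open>Each partial derivative of the field is split into its part along
            \<open>U\<close> and the remainder, the form in which \<open>L\<close> solves for the
            coefficients.\<close>
          have "(\<Sum>k\<in>Basis. euler_symbol k (h (?D k) *\<^sub>R U + (?D k - h (?D k) *\<^sub>R U))) = euler_op \<phi> y"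
            using diff by (subst euler_op_eq) (simp_all add: differentiable_on_def del: split_paired_All)
          also have "euler_op \<phi> y = 0" using \<phi>(4) by blast
          finally show ?thesis unfolding R_def by (rule L(2)[OF _ j])
        qed
        thus "has_dir_deriv j (\<lambda>y. h (\<phi> y)) (\<lambda>y. \<Sum>k\<in>Basis. R j k (frechet_derivative \<phi> (at y) k))"
          using dd[OF h(1), of j] by simp
      next
        fix j k :: "real \<times> (real ^ 'd)"
        show "continuous_on UNIV (\<lambda>y. R j k (frechet_derivative \<phi> (at y) k))"
          using R[of j k] by (intro continuous_on_compose2[OF cont smooth_imp_continuous_derivative[OF \<phi>(1)]]) auto
      qed (use \<phi>(2) in \<open>auto intro!: sq R h dd simp: periodic_def\<close>)
      have int: "integrable torus (\<lambda>y. (a (z + \<phi> y))\<^sup>2)" if "linear a" for a :: "'d state \<Rightarrow> real"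
        by (intro continuous_integrable_torus continuous_intros continuous_on_compose2[OF cont[OF that]] c\<phi>) auto
      have "(\<integral>y. f (z + \<phi> y) \<partial>torus) = (\<Sum>j\<in>Basis. \<Sum>k\<in>Basis. \<integral>y. (R j k (z + \<phi> y))\<^sup>2 \<partial>torus) - (\<integral>y. (h (z + \<phi> y))\<^sup>2 \<partial>torus)"
        unfolding f_def
        by (subst Bochner_Integration.integral_diff Bochner_Integration.integral_sum;
            (intro Bochner_Integration.integrable_sum int R h sum.cong refl)?)+
      also have "\<dots> = f z + ((\<Sum>j\<in>Basis. \<Sum>k\<in>Basis. \<integral>y. (R j k (\<phi> y))\<^sup>2 \<partial>torus) - (\<integral>y. (h (\<phi> y))\<^sup>2 \<partial>torus))"
        by (simp add: sq(2) R h f_def sum.distrib)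
      finally show "ereal (f z) \<le> ereal (\<integral>y. f (z + \<phi> y) \<partial>torus)"
        using est by simp
    qed
  qed
qed

text \<open>Once the difference \<open>U\<close> of the lifts is known to be off the wave cone,
  quasiconvexity bounds the envelope at the barycentre from below by \<open>f\<close>, while the
  two-point average falls short of \<open>f\<close> by the positive amount - l (1 - l) f U.\<close>

lemma euler_envelope_gt_lift:
  fixes u v :: "real ^ 'd::finite"
  assumes l: "0 < l" "l < 1" and uv: "u \<noteq> v" "p \<noteq> q"
  obtains f :: "'d state \<Rightarrow> real" where "continuous_on UNIV f"
    "euler_envelope f (l *\<^sub>R lift (u, p) + (1 - l) *\<^sub>R lift (v, q)) > ereal (l * f (lift (u, p)) + (1 - l) * f (lift (v, q)))"
proof -
  define U where "U = (lift (u, p) - lift (v, q) :: 'd state)"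
  have "\<xi> = 0" if "euler_symbol \<xi> U = 0" for \<xi>
  proof -
    obtain \<tau> k where \<xi>: "\<xi> = (\<tau>, k)" by (cases \<xi>)
    have "k \<bullet> (u - v) = 0" "(\<tau> + u \<bullet> k) *\<^sub>R (u - v) + ((u - v) \<bullet> k) *\<^sub>R v + (p - q) *\<^sub>R k = 0"
      using that by (auto simp: U_def \<xi> euler_symbol_lift_diff zero_prod_def)
    hence orth: "k \<bullet> (u - v) = 0" and eq: "(\<tau> + u \<bullet> k) *\<^sub>R (u - v) + (p - q) *\<^sub>R k = 0"
      by (simp_all add: inner_commute)
    \<comment> \<open>Pairing with k removes the velocity term by orthogonality and leaves (p - q)
      |k|^2; with k = 0 only \<tau> (u - v) remains.\<close>
    have "k \<bullet> ((\<tau> + u \<bullet> k) *\<^sub>R (u - v) + (p - q) *\<^sub>R k) = (p - q) * (k \<bullet> k)"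
      using orth by (simp only: inner_add_right inner_scaleR_right)
    hence "k = 0" using eq uv(2) by simp
    thus ?thesis using eq uv(1) by (simp add: \<xi> zero_prod_def)
  qed
  then obtain f :: "'d state \<Rightarrow> real" where f: "continuous_on UNIV f" "\<And>z. ereal (f z) \<le> euler_envelope f z"
    "\<And>l x. f x + l * (1 - l) * f U = l * f (x + (1 - l) *\<^sub>R U) + (1 - l) * f (x - l *\<^sub>R U)" "f U < 0"
    using quasiconvex_quadratic by blast
  let ?z = "l *\<^sub>R lift (u, p) + (1 - l) *\<^sub>R lift (v, q) :: 'd state"
  have "?z + (1 - l) *\<^sub>R U = lift (u, p)" "?z - l *\<^sub>R U = lift (v, q)"
    by (simp_all add: U_def algebra_simps)
  with f(3)[of ?z l] have "l * f (lift (u, p)) + (1 - l) * f (lift (v, q)) = f ?z + l * (1 - l) * f U"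
    by simp
  also have "\<dots> < f ?z" using l f(4) by (simp add: mult_pos_neg)
  finally have "ereal (l * f (lift (u, p)) + (1 - l) * f (lift (v, q))) < ereal (f ?z)" by simp
  also have "\<dots> \<le> euler_envelope f ?z" by (rule f(2))
  finally show thesis using that f(1) by blast
qed

section \<open>Convex combinations of Dirac measures\<close>

text \<open>As an image of a Bernoulli law the combination is known to be a measure, and its
  integrals become sums over two outcomes.\<close>

lemma convex_comb_return_eq_distr:
  fixes a b :: "'a::topological_space"
  assumes "0 < l" "l < 1"
  shows "convex_comb l (return borel a) (return borel b) =
    distr (measure_pmf (bernoulli_pmf l)) borel (\<lambda>c. if c then a else b)" (is "_ = ?N")
proof -
  have "emeasure ?N A = ennreal l * emeasure (return borel a) A + ennreal (1 - l) * emeasure (return borel b) A"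
    if "A \<in> sets borel" for A
  proof -
    have "emeasure ?N A = (\<integral>\<^sup>+x. indicator A x \<partial>?N)"
      using that by (intro nn_integral_indicator[symmetric]) simp
    also have "\<dots> = (\<integral>\<^sup>+c. indicator A (if c then a else b) \<partial>measure_pmf (bernoulli_pmf l))"
      using that by (intro nn_integral_distr) auto
    also have "\<dots> = ennreal l * emeasure (return borel a) A + ennreal (1 - l) * emeasure (return borel b) A"
      using that assms by (simp add: mult.commute)
    finally show ?thesis .
  qed
  hence "convex_comb l (return borel a) (return borel b) = measure_of (space ?N) (sets ?N) (emeasure ?N)"
    unfolding convex_comb_def
    by (simp, intro measure_of_eq) (auto simp: sets.sigma_sets_eq[of borel, simplified])
  thus ?thesis by (simp only: measure_of_of_measure)
qed

lemma integral_convex_comb_return: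
  fixes f :: "'a::topological_space \<Rightarrow> 'b::{banach, second_countable_topology}"
  assumes "0 < l" "l < 1" "f \<in> borel_measurable borel"
  shows "(\<integral>x. f x \<partial>convex_comb l (return borel a) (return borel b)) = l *\<^sub>R f a + (1 - l) *\<^sub>R f b"
    "integrable (convex_comb l (return borel a) (return borel b)) f"
proof -
  show "(\<integral>x. f x \<partial>convex_comb l (return borel a) (return borel b)) = l *\<^sub>R f a + (1 - l) *\<^sub>R f b"
    using assms
    by (simp add: convex_comb_return_eq_distr integral_distr integral_measure_pmf[of UNIV] UNIV_bool add.commute)
  show "integrable (convex_comb l (return borel a) (return borel b)) f"
    using assms by (simp add: convex_comb_return_eq_distr integrable_distr_eq integrable_measure_pmf_finite)
qed

lemma nn_integral_convex_comb_return:
  assumes "0 < l" "l < 1" "f \<in> borel_measurable borel"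
  shows "(\<integral>\<^sup>+x. f x \<partial>convex_comb l (return borel a) (return borel b)) = ennreal l * f a + ennreal (1 - l) * f b"
  using assms by (simp add: convex_comb_return_eq_distr nn_integral_distr mult.commute)

lemma prob_space_convex_comb_return:
  assumes "0 < l" "l < 1"
  shows "prob_space (convex_comb l (return borel a) (return borel b))"
    "sets (convex_comb l (return borel a) (return borel b)) = sets borel"
  using assms by (auto simp: convex_comb_return_eq_distr intro!: measure_pmf.prob_space_distr)

lemma lift_measurable: "lift \<in> measurable borel (restrict_space borel (states :: 'd::finite state set))"
  by (intro measurable_restrict_space2 borel_measurable_continuous_onI continuous_lift) (auto simp: lift_in_states)

lemma integral_push_lift:
  fixes f :: "'d::finite state \<Rightarrow> 'b::{banach, second_countable_topology}"
  assumes "0 < l" "l < 1" "continuous_on states f"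
  shows "(\<integral>w. f w \<partial>push_lift (convex_comb l (return borel a) (return borel b))) = l *\<^sub>R f (lift a) + (1 - l) *\<^sub>R f (lift b)"
proof -
  have f: "f \<in> borel_measurable (restrict_space borel states)"
    by (rule borel_measurable_continuous_on_restrict[OF assms(3)])
  have "lift \<in> measurable (convex_comb l (return borel a) (return borel b)) (restrict_space borel (states :: 'd state set))"
    using lift_measurable measurable_cong_sets[OF prob_space_convex_comb_return(2)[OF assms(1,2)] refl] by blast
  thus ?thesis
    unfolding push_lift_def
    by (subst integral_distr[OF _ f])
       (auto intro!: integral_convex_comb_return(1)[OF assms(1,2), of "\<lambda>w. f (lift w)"] measurable_compose[OF lift_measurable f])
qed

text \<open>This holds at every point and without exceptions, so it can be rewritten directly under
  the almost-everywhere quantifier.\<close>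

lemma jensen_lift_iff:
  fixes u v :: "real ^ 2" and p q :: real
  assumes l: "0 < l" "l < 1"
  defines "\<mu> \<equiv> push_lift (convex_comb l (return borel (u, p)) (return borel (v, q)))"
  shows "(\<forall>f. continuous_on states f \<longrightarrow> ereal (\<integral>w. f w \<partial>\<mu>) \<ge> euler_envelope f (\<integral>w. w \<partial>\<mu>)) \<longleftrightarrow> u = v \<or> p = q"
    (is "?J \<longleftrightarrow> _")
proof -
  have mean: "(\<integral>w. w \<partial>\<mu>) = l *\<^sub>R lift (u, p) + (1 - l) *\<^sub>R lift (v, q)"
    unfolding \<mu>_def by (rule integral_push_lift[OF l]) simp
  have int: "(\<integral>w. f w \<partial>\<mu>) = l * f (lift (u, p)) + (1 - l) * f (lift (v, q))"
    if "continuous_on states f" for f :: "2 state \<Rightarrow> real"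
    unfolding \<mu>_def using integral_push_lift[OF l that] by simp
  show ?thesis
  proof
    assume J: ?J
    show "u = v \<or> p = q"
    proof (rule ccontr)
      assume "\<not> (u = v \<or> p = q)"
      then obtain f :: "2 state \<Rightarrow> real" where f: "continuous_on UNIV f"
        "euler_envelope f (l *\<^sub>R lift (u, p) + (1 - l) *\<^sub>R lift (v, q)) > ereal (l * f (lift (u, p)) + (1 - l) * f (lift (v, q)))"
        using euler_envelope_gt_lift[OF l, of u v p q] by blast
      have "continuous_on states f" using f(1) continuous_on_subset by blast
      with J f(2) show False by (auto simp: mean int)
    qed
  next
    assume "u = v \<or> p = q"
    thus ?J using euler_envelope_le_lift[OF l] by (auto simp: mean int)
  qed
qed

section \<open>Time slices, and mixtures of weak solutions\<close>

lemma AE_integrable_section: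
  fixes g :: "'a::euclidean_space \<times> 'b::euclidean_space \<Rightarrow> real"
  assumes AB: "A \<in> sets borel" "B \<in> sets borel" and g: "integrable (lebesgue_on (A \<times> B)) g"
  shows "AE t in lebesgue_on A. integrable (lebesgue_on B) (\<lambda>x. g (t, x))"
proof -
  have [measurable]: "A \<times> B \<in> sets borel" using AB by (simp add: borel_prod[symmetric])
  let ?G = "\<lambda>z. indicator (A \<times> B) z *\<^sub>R g z"
  have G: "integrable lebesgue ?G"
    using g by (subst (asm) integrable_restrict_space) auto
  \<comment> \<open>Lebesgue measure on the product is a completion, and Fubini is stated for the
    product of Borel measures. A Borel version is sliced instead, and the almost-everywhere equality
    is carried to almost all slices.\<close>
  then obtain G' where G': "G' \<in> borel_measurable lborel" "AE z in lborel. ?G z = G' z"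
    using completion_ex_borel_measurable_real[OF borel_measurable_integrable[OF G]] by blast
  have "integrable lebesgue G'"
    by (rule integrable_cong_AE_imp[OF G]) (use G' in \<open>auto intro!: measurable_completion AE_completion elim: eventually_mono\<close>)
  hence "integrable (lborel \<Otimes>\<^sub>M lborel) G'"
    using G'(1) by (simp add: integrable_completion lborel_prod)
  hence int: "AE t in lborel. integrable lborel (\<lambda>x. G' (t, x))"
    by (rule lborel_pair.AE_integrable_fst')
  have eq: "AE t in lborel. AE x in lborel. ?G (t, x) = G' (t, x)"
    using lborel_pair.AE_pair[of "\<lambda>z. ?G z = G' z"] G'(2) by (simp only: lborel_prod)
  have "AE t in lborel. t \<in> A \<longrightarrow> integrable (lebesgue_on B) (\<lambda>x. g (t, x))"
    using int eq
  proof eventually_elim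
    case (elim t)
    show ?case
    proof
      assume t: "t \<in> A"
      have int_G': "integrable lebesgue (\<lambda>x. G' (t, x))"
        using elim(1) by (subst integrable_completion) auto
      have ae: "AE x in lebesgue. G' (t, x) = ?G (t, x)"
        using elim(2) by (intro AE_completion) (auto elim: eventually_mono)
      have "integrable lebesgue (\<lambda>x. ?G (t, x))"
        by (rule integrable_cong_AE_imp[OF int_G' borel_measurable_AE[OF borel_measurable_integrable[OF int_G'] ae] ae])
      also have "(\<lambda>x. ?G (t, x)) = (\<lambda>x. indicator B x *\<^sub>R g (t, x))"
        using t by (simp add: indicator_def fun_eq_iff)
      finally show "integrable (lebesgue_on B) (\<lambda>x. g (t, x))"
        using AB by (subst integrable_restrict_space) auto
    qed
  qed
  hence "AE t in lebesgue. t \<in> A \<longrightarrow> integrable (lebesgue_on B) (\<lambda>x. g (t, x))"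
    by (rule AE_completion)
  thus ?thesis using AB by (subst AE_restrict_space_iff) auto
qed

lemma spacetime_borel: "(spacetime T :: (real \<times> (real ^ 'd)) set) \<in> sets borel"
  unfolding spacetime_def borel_prod[symmetric] by (intro pair_measureI) auto

text \<open>The divergence constraint concerns single time slices; splitting the slice integral of a
  mixture requires both slices to be integrable.\<close>

lemma integrable_section:
  fixes u :: "real \<times> (real ^ 'd) \<Rightarrow> 'b::euclidean_space"
  assumes "integrable (lebesgue_on (spacetime T)) u"
  shows "AE t in lebesgue_on {0<..<T}. integrable torus (\<lambda>x. u (t, x))"
proof -
  have "AE t in lebesgue_on {0<..<T}. \<forall>b\<in>Basis. integrable torus (\<lambda>x. u (t, x) \<bullet> b)"
    using assms
    by (intro AE_finite_allI AE_integrable_section) (auto simp: spacetime_def)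
  thus ?thesis
  proof eventually_elim
    case (elim t)
    hence "integrable torus (\<lambda>x. \<Sum>b\<in>Basis. (u (t, x) \<bullet> b) *\<^sub>R b)"
      by (intro Bochner_Integration.integrable_sum integrable_scaleR_left) auto
    thus ?case by (simp add: euclidean_representation)
  qed
qed

lemma continuous_grad:
  fixes \<psi> :: "real ^ 'd \<Rightarrow> real"
  assumes "smooth \<psi>"
  shows "continuous_on UNIV (grad \<psi>)"
  unfolding grad_def [abs_def] by (intro continuous_intros smooth_imp_continuous_derivative assms)

lemma integrable_torus_inner:
  fixes g w :: "'a::euclidean_space \<Rightarrow> 'b::euclidean_space"
  assumes g: "continuous_on UNIV g" and w: "integrable torus w"
  shows "integrable torus (\<lambda>x. g x \<bullet> w x)"
proof -
  have "compact (g ` cbox 0 One)"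
    by (intro compact_continuous_image continuous_on_subset[OF g]) auto
  then obtain B where B: "\<And>x. x \<in> cbox 0 One \<Longrightarrow> norm (g x) \<le> B"
    using compact_imp_bounded by (metis bounded_iff imageI)
  have [measurable]: "g \<in> borel_measurable torus"
    by (intro borel_measurable_torus borel_measurable_continuous_onI g)
  have [measurable]: "w \<in> borel_measurable torus" using w by auto
  show ?thesis
  proof (rule Bochner_Integration.integrable_bound)
    show "integrable torus (\<lambda>x. B * norm (w x))" using w by auto
    show "AE x in torus. norm (g x \<bullet> w x) \<le> norm (B * norm (w x))"
    proof (intro AE_I2)
      fix x :: 'a assume "x \<in> space torus"
      hence "norm (g x) \<le> B" using B unit_cell_bounds(2) by auto
      hence "norm (g x) * norm (w x) \<le> B * norm (w x)" by (intro mult_right_mono) auto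
      thus "norm (g x \<bullet> w x) \<le> norm (B * norm (w x))"
        using Cauchy_Schwarz_ineq2[of "g x" "w x"] by simp
    qed
  qed measurable
qed

lemma borel_measurable_state_components:
  "(\<lambda>(u :: real ^ 'd, P :: real). u) \<in> borel_measurable borel"
  "(\<lambda>(u :: real ^ 'd, P :: real). P) \<in> borel_measurable borel"
  "(\<lambda>(u :: real ^ 'd, P :: real). tensor u u) \<in> borel_measurable borel"
  "(\<lambda>(u :: real ^ 'd, P :: real). ennreal ((norm u)\<^sup>2)) \<in> borel_measurable borel"
  unfolding case_prod_unfold tensor_def
  by (intro measurable_compose[OF _ measurable_ennreal] borel_measurable_continuous_onI continuous_intros)+

text \<open>Averages against a Dirac measure are evaluations, which turns the measure-valued
  formulation into the classical weak one.\<close>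

lemma augmented_mv_solution_returnD:
  fixes u :: "real \<times> (real ^ 'd) \<Rightarrow> real ^ 'd"
  assumes "augmented_mv_solution T u\<^sub>0 (\<lambda>z. return borel (u z, P z))"
  shows "integrable torus u\<^sub>0 \<and>
     (\<forall>f :: (real ^ 'd) \<times> real \<Rightarrow> real. continuous_on UNIV f \<and> (f \<longlongrightarrow> 0) at_infinity \<longrightarrow>
        (\<lambda>z. f (u z, P z)) \<in> borel_measurable (lebesgue_on (spacetime T))) \<and>
     (\<exists>C::real. AE z in lebesgue_on (spacetime T). ennreal ((norm (u z))\<^sup>2) \<le> ennreal C) \<and>
     (\<forall>\<phi>\<in>test_fields T.
        let F = (\<lambda>z. D_t \<phi> z \<bullet> u z + grad_x \<phi> z \<bullet> tensor (u z) (u z) + P z * div_x \<phi> z)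
        in integrable (lebesgue_on (spacetime T)) F \<and>
           integral\<^sup>L (lebesgue_on (spacetime T)) F = - (\<integral>x. \<phi> (0, x) \<bullet> u\<^sub>0 x \<partial>torus)) \<and>
     (\<forall>\<psi>. smooth \<psi> \<and> periodic \<psi> \<longrightarrow>
        (AE t in lebesgue_on {0<..<T}. (\<integral>x. grad \<psi> x \<bullet> u (t, x) \<partial>torus) = 0))"
proof -
  have int: "(\<integral>x. f x \<partial>return borel a) = f a" if "f \<in> borel_measurable borel"
    for a :: "(real ^ 'd) \<times> real" and f :: "_ \<Rightarrow> 'c::{banach, second_countable_topology}"
    using that by (intro integral_return) auto
  note m = borel_measurable_state_components
  have C0: "(\<integral>x. f x \<partial>return borel a) = f a" if "continuous_on UNIV f"
    for a :: "(real ^ 'd) \<times> real" and f :: "_ \<Rightarrow> real"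
    using that by (intro integral_return borel_measurable_continuous_onI) auto
  show ?thesis
    using assms unfolding augmented_mv_solution_def young_measure_def
    by (simp add: int[OF m(1)] int[OF m(2)] int[OF m(3)] nn_integral_return m C0 cong: conj_cong imp_cong)
qed

text \<open>The equations are linear in the measure, as u \<otimes> u is averaged and not formed
  from averages. Both solutions share the initial data, so the right-hand sides combine with total
  weight one.\<close>

lemma augmented_mv_solution_convex_comb:
  fixes u\<^sub>1 u\<^sub>2 :: "real \<times> (real ^ 'd) \<Rightarrow> real ^ 'd"
  assumes l: "0 < l" "l < 1" and w: "weak_solution T u\<^sub>0 u\<^sub>1 P\<^sub>1" "weak_solution T u\<^sub>0 u\<^sub>2 P\<^sub>2"
  shows "augmented_mv_solution T u\<^sub>0 (\<lambda>z. convex_comb l (return borel (u\<^sub>1 z, P\<^sub>1 z)) (return borel (u\<^sub>2 z, P\<^sub>2 z)))"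
    (is "augmented_mv_solution _ _ ?\<nu>")
proof -
  note m = borel_measurable_state_components
  note w1 = w(1)[unfolded weak_solution_def]
    augmented_mv_solution_returnD[OF w(1)[unfolded weak_solution_def, THEN conjunct2, THEN conjunct2], unfolded Let_def]
  note w2 = w(2)[unfolded weak_solution_def]
    augmented_mv_solution_returnD[OF w(2)[unfolded weak_solution_def, THEN conjunct2, THEN conjunct2], unfolded Let_def]
  note ic = integral_convex_comb_return[OF l]
  show ?thesis
    unfolding augmented_mv_solution_def Let_def
  proof (intro conjI ballI allI impI)
    show "integrable torus u\<^sub>0" using w1 by blast
    show "young_measure T ?\<nu>"
      unfolding young_measure_def
    proof (intro conjI ballI allI impI prob_space_convex_comb_return l)
      fix f :: "(real ^ 'd) \<times> real \<Rightarrow> real"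
      assume f: "continuous_on UNIV f \<and> (f \<longlongrightarrow> 0) at_infinity"
      have "(\<lambda>z. l * f (u\<^sub>1 z, P\<^sub>1 z) + (1 - l) * f (u\<^sub>2 z, P\<^sub>2 z)) \<in> borel_measurable (lebesgue_on (spacetime T))"
        using w1 w2 f by (intro borel_measurable_add borel_measurable_times borel_measurable_const) blast+
      thus "(\<lambda>z. integral\<^sup>L (?\<nu> z) f) \<in> borel_measurable (lebesgue_on (spacetime T))"
        using f by (simp add: ic(1) borel_measurable_continuous_onI)
    qed
    obtain C D :: real where C: "AE z in lebesgue_on (spacetime T). ennreal ((norm (u\<^sub>1 z))\<^sup>2) \<le> ennreal C"
      and D: "AE z in lebesgue_on (spacetime T). ennreal ((norm (u\<^sub>2 z))\<^sup>2) \<le> ennreal D"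
      using w1 w2 by blast
    \<comment> \<open>The bounds may be negative reals, and \<open>ennreal\<close> is additive and
      multiplicative only for nonnegative ones; hence the maximum with 0.\<close>
    have "AE z in lebesgue_on (spacetime T). (\<integral>\<^sup>+(u, P). ennreal ((norm u)\<^sup>2) \<partial>?\<nu> z) \<le> ennreal (l * max 0 C + (1 - l) * max 0 D)"
      using C D
    proof eventually_elim
      case (elim z)
      have "ennreal l * ennreal ((norm (u\<^sub>1 z))\<^sup>2) + ennreal (1 - l) * ennreal ((norm (u\<^sub>2 z))\<^sup>2)
          \<le> ennreal l * ennreal (max 0 C) + ennreal (1 - l) * ennreal (max 0 D)"
        using elim by (intro add_mono mult_left_mono) (auto intro: order_trans ennreal_leI)
      also have "\<dots> = ennreal (l * max 0 C + (1 - l) * max 0 D)"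
        using l by (simp add: ennreal_mult ennreal_plus)
      finally show ?case
        by (simp add: nn_integral_convex_comb_return[OF l m(4)])
    qed
    thus "\<exists>C::real. AE z in lebesgue_on (spacetime T). (\<integral>\<^sup>+(u, P). ennreal ((norm u)\<^sup>2) \<partial>?\<nu> z) \<le> ennreal C" by blast
    show "AE z in lebesgue_on (spacetime T). integrable (?\<nu> z) (\<lambda>(u, P). P)"
      by (intro AE_I2 ic(2) m)
  next
    fix \<phi> :: "real \<times> (real ^ 'd) \<Rightarrow> real ^ 'd" assume \<phi>: "\<phi> \<in> test_fields T"
    let ?S = "lebesgue_on (spacetime T)"
    let ?F = "\<lambda>u P z. D_t \<phi> z \<bullet> u z + grad_x \<phi> z \<bullet> tensor (u z) (u z) + P z * div_x \<phi> z"
    have F: "integrable ?S (?F u\<^sub>1 P\<^sub>1)" "integral\<^sup>L ?S (?F u\<^sub>1 P\<^sub>1) = - (\<integral>x. \<phi> (0, x) \<bullet> u\<^sub>0 x \<partial>torus)"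
      "integrable ?S (?F u\<^sub>2 P\<^sub>2)" "integral\<^sup>L ?S (?F u\<^sub>2 P\<^sub>2) = - (\<integral>x. \<phi> (0, x) \<bullet> u\<^sub>0 x \<partial>torus)"
      using w1 w2 \<phi> by blast+
    have I: "integrable ?S (\<lambda>z. l * ?F u\<^sub>1 P\<^sub>1 z)" "integrable ?S (\<lambda>z. (1 - l) * ?F u\<^sub>2 P\<^sub>2 z)"
      by (rule integrable_mult_right, rule F)+
    have eq: "D_t \<phi> z \<bullet> (\<integral>(u, P). u \<partial>?\<nu> z) + grad_x \<phi> z \<bullet> (\<integral>(u, P). tensor u u \<partial>?\<nu> z) + (\<integral>(u, P). P \<partial>?\<nu> z) * div_x \<phi> z
      = l * ?F u\<^sub>1 P\<^sub>1 z + (1 - l) * ?F u\<^sub>2 P\<^sub>2 z" for z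
      by (simp add: ic(1)[OF m(1)] ic(1)[OF m(2)] ic(1)[OF m(3)] inner_add_right algebra_simps)
    show "integrable ?S (\<lambda>z. D_t \<phi> z \<bullet> (\<integral>(u, P). u \<partial>?\<nu> z) + grad_x \<phi> z \<bullet> (\<integral>(u, P). tensor u u \<partial>?\<nu> z) + (\<integral>(u, P). P \<partial>?\<nu> z) * div_x \<phi> z)"
      unfolding eq by (rule Bochner_Integration.integrable_add[OF I])
    show "(\<integral>z. D_t \<phi> z \<bullet> (\<integral>(u, P). u \<partial>?\<nu> z) + grad_x \<phi> z \<bullet> (\<integral>(u, P). tensor u u \<partial>?\<nu> z) + (\<integral>(u, P). P \<partial>?\<nu> z) * div_x \<phi> z \<partial>?S)
        = - (\<integral>x. \<phi> (0, x) \<bullet> u\<^sub>0 x \<partial>torus)"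
      unfolding eq
        Bochner_Integration.integral_add[OF I]
        integral_mult_right_zero F(2) F(4)
      by (simp add: algebra_simps)
  next
    fix \<psi> :: "real ^ 'd \<Rightarrow> real" assume \<psi>: "smooth \<psi> \<and> periodic \<psi>"
    have "AE t in lebesgue_on {0<..<T}. (\<integral>x. grad \<psi> x \<bullet> u\<^sub>1 (t, x) \<partial>torus) = 0"
      "AE t in lebesgue_on {0<..<T}. (\<integral>x. grad \<psi> x \<bullet> u\<^sub>2 (t, x) \<partial>torus) = 0"
      "AE t in lebesgue_on {0<..<T}. integrable torus (\<lambda>x. u\<^sub>1 (t, x))"
      "AE t in lebesgue_on {0<..<T}. integrable torus (\<lambda>x. u\<^sub>2 (t, x))"
      using w1 w2 \<psi> by (blast intro: integrable_section)+
    thus "AE t in lebesgue_on {0<..<T}. (\<integral>x. grad \<psi> x \<bullet> (\<integral>(u, P). u \<partial>?\<nu> (t, x)) \<partial>torus) = 0"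
    proof eventually_elim
      case (elim t)
      have i: "integrable torus (\<lambda>x. grad \<psi> x \<bullet> u\<^sub>1 (t, x))" "integrable torus (\<lambda>x. grad \<psi> x \<bullet> u\<^sub>2 (t, x))"
        using elim \<psi> by (auto intro!: integrable_torus_inner continuous_grad)
      have "(\<integral>x. grad \<psi> x \<bullet> (\<integral>(u, P). u \<partial>?\<nu> (t, x)) \<partial>torus) = (\<integral>x. l * (grad \<psi> x \<bullet> u\<^sub>1 (t, x)) + (1 - l) * (grad \<psi> x \<bullet> u\<^sub>2 (t, x)) \<partial>torus)"
        by (simp add: ic(1)[OF m(1)] inner_add_right)
      also have "\<dots> = l * (\<integral>x. grad \<psi> x \<bullet> u\<^sub>1 (t, x) \<partial>torus) + (1 - l) * (\<integral>x. grad \<psi> x \<bullet> u\<^sub>2 (t, x) \<partial>torus)"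
        using i by (subst Bochner_Integration.integral_add) auto
      finally show ?case using elim by simp
    qed
  qed
qed

theorem proposition6p1:
  fixes T l :: real
    and u\<^sub>0 :: "(real ^ 2) \<Rightarrow> (real ^ 2)"
    and u\<^sub>1 u\<^sub>2 :: "real \<times> (real ^ 2) \<Rightarrow> (real ^ 2)"
    and P\<^sub>1 P\<^sub>2 :: "real \<times> (real ^ 2) \<Rightarrow> real"
    and \<nu> :: "real \<times> (real ^ 2) \<Rightarrow> ((real ^ 2) \<times> real) measure"
  assumes "T > 0" and "0 < l" and "l < 1"
    and "weak_solution T u\<^sub>0 u\<^sub>1 P\<^sub>1" and "weak_solution T u\<^sub>0 u\<^sub>2 P\<^sub>2"
  defines "\<nu> \<equiv> \<lambda>z. convex_comb l (return borel (u\<^sub>1 z, P\<^sub>1 z)) (return borel (u\<^sub>2 z, P\<^sub>2 z))"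
  shows "augmented_mv_solution T u\<^sub>0 \<nu> \<and>
    (\<not> jensen_condition T \<nu> \<longleftrightarrow>
      emeasure lebesgue {z \<in> spacetime T. u\<^sub>1 z \<noteq> u\<^sub>2 z \<and> P\<^sub>1 z \<noteq> P\<^sub>2 z} > 0)"
proof
  show "augmented_mv_solution T u\<^sub>0 \<nu>"
    unfolding \<nu>_def by (rule augmented_mv_solution_convex_comb) fact+
  have S: "(spacetime T :: (real \<times> (real ^ 2)) set) \<in> sets lebesgue"
    by (intro sets_completionI_sets) (simp add: spacetime_borel)
  let ?M = "lebesgue_on (spacetime T :: (real \<times> (real ^ 2)) set)"
  have [measurable]: "u\<^sub>1 \<in> borel_measurable ?M" "u\<^sub>2 \<in> borel_measurable ?M"
    "P\<^sub>1 \<in> borel_measurable ?M" "P\<^sub>2 \<in> borel_measurable ?M"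
    using assms(4,5) by (auto simp: weak_solution_def)
  let ?E = "{z \<in> spacetime T. u\<^sub>1 z \<noteq> u\<^sub>2 z \<and> P\<^sub>1 z \<noteq> P\<^sub>2 z}"
  \<comment> \<open>Measurability of this set, which comes from the integrability of the solutions,
    lets the almost-everywhere statement be expressed as measure zero.\<close>
  have "{z \<in> space ?M. u\<^sub>1 z \<noteq> u\<^sub>2 z \<and> P\<^sub>1 z \<noteq> P\<^sub>2 z} \<in> sets ?M"
    by measurable
  hence E: "?E \<in> sets lebesgue"
    using S by (simp add: sets_restrict_space_iff)
  \<comment> \<open>The pointwise equivalence introduces no null set of its own.\<close>
  have "jensen_condition T \<nu> \<longleftrightarrow> (AE z in ?M. u\<^sub>1 z = u\<^sub>2 z \<or> P\<^sub>1 z = P\<^sub>2 z)"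
    unfolding jensen_condition_def \<nu>_def jensen_lift_iff[OF assms(2,3)] ..
  also have "\<dots> \<longleftrightarrow> (AE z in lebesgue. z \<notin> ?E)"
    using S by (subst AE_restrict_space_iff) (auto intro!: AE_cong)
  also have "\<dots> \<longleftrightarrow> emeasure lebesgue ?E = 0"
    using E by (subst AE_iff_measurable[of ?E]) auto
  finally show "\<not> jensen_condition T \<nu> \<longleftrightarrow> emeasure lebesgue ?E > 0"
    by (simp add: zero_less_iff_neq_zero)
qed

end
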